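(* Let $\xi$ be a Hopf vector field on the unit sphere $S^{2m+1}$. With respect to the structure induced from the standard contact metric structure $(\tilde\xi,\tilde\eta,\tilde\varphi,g_{cm})$ of $T_1S^{2m+1}$, the manifold $\xi(S^{2m+1})$ is a Sasakian space form of $\varphi$-curvature $5/4$.
   Context: A Hopf vector field on $S^{2m+1}\subset\mathbb R^{2m+2}$ is a unit vector field of the form $\xi(x)=Ix$, where $I$ is an orthogonal complex structure on $\mathbb R^{2m+2}$ ($I$ orthogonal, $I^2=-\mathrm{Id}$). It is viewed as the imbedding $q\mapsto(q,\xi(q))$ of $S^{2m+1}$ into its unit tangent bundle $T_1S^{2m+1}$, with image $\xi(S^{2m+1})$. Sasaki metric: for $M=S^{2m+1}$ with the round metric $\langle\cdot,\cdot\rangle$ and its Levi-Civita connection, at $Q=(q,\xi)\in TM$ each $X\in T_qM$ has a horizontal lift $X^h$ and a vertical lift $X^v$ in $T_QTM$; the Sasaki metric $g_S=\langle\langle\cdot,\cdot\rangle\rangle$ is determined by $\langle\langle X^h,Y^h\rangle\rangle=\langle X,Y\rangle$, $\langle\langle X^h,Y^v\rangle\rangle=0$, $\langle\langle X^v,Y^v\rangle\rangle=\langle X,Y\rangle$. The unit tangent bundle $T_1M$ carries the induced metric (also denoted $g_S$); its unit normal in $TM$ at $(q,\xi)$ is $\xi^v$. Standard contact metric structure on $T_1M$: let $J$ be the almost complex structure on $TM$ with $JX^h=X^v$, $JX^v=-X^h$. On $T_1M$ define, at $(q,\xi)$, $\bar\xi=-J\xi^v=\xi^h$, and a 1-form $\bar\eta$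 and $(1,1)$-tensor $\bar\varphi$ by $J\tilde X=\bar\varphi\tilde X+\bar\eta(\tilde X)\xi^v$ for $\tilde X$ tangent to $T_1M$ (with $\bar\varphi\tilde X$ tangent to $T_1M$). Put $\tilde\xi=2\bar\xi$, $\tilde\eta=\tfrac12\bar\eta$, $\tilde\varphi=\bar\varphi$, $g_{cm}=\tfrac14g_S$. For the Hopf field, $\xi(S^{2m+1})$ is an invariant submanifold: $\tilde\xi$ is tangent to it and $\tilde\varphi$ preserves its tangent spaces. Hence $(\tilde\xi,\tilde\eta,\tilde\varphi,g_{cm})$ restricts to $\xi(S^{2m+1})$, and this restriction is the induced structure. A contact metric structure $(\xi,\eta,\varphi,g)$ is Sasakian if $(\nabla_X\varphi)Y=g(X,Y)\xi-\eta(Y)X$ for the Levi-Civita connection $\nabla$ of $g$. A $\varphi$-section is a tangent plane spanned by $X$ and $\varphi X$ with $X\neq0$ orthogonal to the characteristic field; a Sasakian space form is a Sasakian manifold all of whose $\varphi$-sections have the same sectional curvature, called the $\varphi$-curvature.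
   Formalization: The φ-curvature with respect to g_cm is 5, not 5/4 (already on S^3), since g_cm = g_S/4; the formal theorem says ξ(S^{2m+1}) is a Sasakian space form for g_cm of some constant φ-curvature, and that the value 5/4 holds for the Sasaki metric g_S. *)

theory Defs
  imports "HOL-Analysis.Analysis"
begin

section \<open>Submanifolds of Euclidean space\<close>

text \<open>
  Manifolds are embedded submanifolds of a Euclidean space. Tangent vectors are ambient vectors,
  vector fields are ambient maps of which only the values on the submanifold matter, and tensors
  are families of maps indexed by points, of which only the values on tangent vectors matter.
\<close>

primrec Ck_on ::
  "nat \<Rightarrow> ('e::euclidean_space \<Rightarrow> 'f::real_normed_vector) \<Rightarrow> 'e set \<Rightarrow> bool" where
  "Ck_on 0 f U \<longleftrightarrow> continuous_on U f"
| "Ck_on (Suc k) f U \<longleftrightarrow> (\<forall>x\<in>U. f differentiable (at x)) \<and>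
     (\<forall>v. Ck_on k (\<lambda>x. frechet_derivative f (at x) v) U)"

definition smooth_on :: "('e::euclidean_space \<Rightarrow> 'f::real_normed_vector) \<Rightarrow> 'e set \<Rightarrow> bool" where
  "smooth_on f U \<longleftrightarrow> (\<forall>k. Ck_on k f U)"

text \<open>Locally, a \<open>k\<close>-dimensional submanifold is a regular level set. The subspace \<open>C\<close> plays
  the role of the target \<open>\<real>\<^sup>c\<close>, where \<open>c\<close> is the codimension.\<close>

definition submanifold :: "nat \<Rightarrow> 'e::euclidean_space set \<Rightarrow> bool" where
  "submanifold k N \<longleftrightarrow> (\<forall>p\<in>N. \<exists>U C. \<exists>F :: 'e \<Rightarrow> 'e.
     open U \<and> p \<in> U \<and> subspace C \<and> dim C + k = DIM('e) \<and>
     smooth_on F U \<and> F ` U \<subseteq> C \<and> N \<inter> U = {x \<in> U. F x = 0} \<and>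
     range (frechet_derivative F (at p)) = C)"

definition tangent_space :: "'e::euclidean_space set \<Rightarrow> 'e \<Rightarrow> 'e set" where
  "tangent_space N p = {v. \<exists>\<gamma> :: real \<Rightarrow> 'e.
     range \<gamma> \<subseteq> N \<and> \<gamma> 0 = p \<and> (\<gamma> has_vector_derivative v) (at 0)}"

definition smooth_map :: "'e::euclidean_space set \<Rightarrow> ('e \<Rightarrow> 'f::real_normed_vector) \<Rightarrow> bool" where
  "smooth_map N f \<longleftrightarrow>
     (\<forall>p\<in>N. \<exists>U F. open U \<and> p \<in> U \<and> smooth_on F U \<and> (\<forall>x\<in>U \<inter> N. F x = f x))"

text \<open>A derivative of \<open>f\<close> at \<open>p\<close> within \<open>N\<close> is not unique as a linear map on the ambient
  space, but any two of them agree on the tangent space, where alone \<open>tderiv\<close> is used.\<close>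

definition tderiv ::
  "'e::euclidean_space set \<Rightarrow> ('e \<Rightarrow> 'f::real_normed_vector) \<Rightarrow> 'e \<Rightarrow> 'e \<Rightarrow> 'f" where
  "tderiv N f p v = frechet_derivative f (at p within N) v"

definition vector_field :: "'e::euclidean_space set \<Rightarrow> ('e \<Rightarrow> 'e) \<Rightarrow> bool" where
  "vector_field N X \<longleftrightarrow> smooth_map N X \<and> (\<forall>p\<in>N. X p \<in> tangent_space N p)"

definition lie_bracket ::
  "'e::euclidean_space set \<Rightarrow> ('e \<Rightarrow> 'e) \<Rightarrow> ('e \<Rightarrow> 'e) \<Rightarrow> 'e \<Rightarrow> 'e" where
  "lie_bracket N X Y p = tderiv N Y p (X p) - tderiv N X p (Y p)"


section \<open>Riemannian metrics, Levi-Civita connection, curvature\<close>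

type_synonym 'e metric = "'e \<Rightarrow> 'e \<Rightarrow> 'e \<Rightarrow> real"

definition riemannian_metric :: "'e::euclidean_space set \<Rightarrow> 'e metric \<Rightarrow> bool" where
  "riemannian_metric N g \<longleftrightarrow>
     (\<forall>p\<in>N. \<forall>u\<in>tangent_space N p. \<forall>v\<in>tangent_space N p. \<forall>w\<in>tangent_space N p. \<forall>a b.
        g p u v = g p v u \<and>
        g p (a *\<^sub>R u + b *\<^sub>R v) w = a * g p u w + b * g p v w \<and>
        (u \<noteq> 0 \<longrightarrow> g p u u > 0)) \<and>
     (\<forall>X Y. vector_field N X \<and> vector_field N Y \<longrightarrow> smooth_map N (\<lambda>p. g p (X p) (Y p)))"

type_synonym 'e connection = "('e \<Rightarrow> 'e) \<Rightarrow> ('e \<Rightarrow> 'e) \<Rightarrow> 'e \<Rightarrow> 'e"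

definition affine_connection :: "'e::euclidean_space set \<Rightarrow> 'e connection \<Rightarrow> bool" where
  "affine_connection N D \<longleftrightarrow>
     (\<forall>X Y. vector_field N X \<and> vector_field N Y \<longrightarrow> vector_field N (D X Y)) \<and>
     (\<forall>X X' Y Y'. vector_field N X \<and> vector_field N X' \<and> vector_field N Y \<and> vector_field N Y' \<and>
        (\<forall>p\<in>N. X p = X' p \<and> Y p = Y' p) \<longrightarrow> (\<forall>p\<in>N. D X Y p = D X' Y' p)) \<and>
     (\<forall>X X' Y Y' f. vector_field N X \<and> vector_field N X' \<and> vector_field N Y \<and> vector_field N Y' \<and>
        smooth_map N f \<longrightarrow>
        (\<forall>p\<in>N.
           D (\<lambda>x. X x + X' x) Y p = D X Y p + D X' Y p \<and>
           D (\<lambda>x. f x *\<^sub>R X x) Y p = f p *\<^sub>R D X Y p \<and>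
           D X (\<lambda>x. Y x + Y' x) p = D X Y p + D X Y' p \<and>
           D X (\<lambda>x. f x *\<^sub>R Y x) p = tderiv N f p (X p) *\<^sub>R Y p + f p *\<^sub>R D X Y p))"

definition is_levi_civita :: "'e::euclidean_space set \<Rightarrow> 'e metric \<Rightarrow> 'e connection \<Rightarrow> bool" where
  "is_levi_civita N g D \<longleftrightarrow> affine_connection N D \<and>
     (\<forall>X Y. vector_field N X \<and> vector_field N Y \<longrightarrow>
        (\<forall>p\<in>N. D X Y p - D Y X p = lie_bracket N X Y p)) \<and>
     (\<forall>X Y Z. vector_field N X \<and> vector_field N Y \<and> vector_field N Z \<longrightarrow>
        (\<forall>p\<in>N. tderiv N (\<lambda>x. g x (Y x) (Z x)) p (X p) =
           g p (D X Y p) (Z p) + g p (Y p) (D X Z p)))"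

text \<open>By the fundamental lemma of Riemannian geometry the value of the following operator is
  determined at vector fields and points of \<open>N\<close>; elsewhere it is arbitrary.\<close>

definition levi_civita :: "'e::euclidean_space set \<Rightarrow> 'e metric \<Rightarrow> 'e connection" where
  "levi_civita N g = (SOME D. is_levi_civita N g D)"

definition curvature_op ::
  "'e::euclidean_space set \<Rightarrow> 'e metric \<Rightarrow> ('e \<Rightarrow> 'e) \<Rightarrow> ('e \<Rightarrow> 'e) \<Rightarrow> ('e \<Rightarrow> 'e) \<Rightarrow> 'e \<Rightarrow> 'e" where
  "curvature_op N g X Y Z p =
     (let D = levi_civita N g in
        D X (D Y Z) p - D Y (D X Z) p - D (lie_bracket N X Y) Z p)"

definition curvature_tensor ::
  "'e::euclidean_space set \<Rightarrow> 'e metric \<Rightarrow> 'e \<Rightarrow> 'e \<Rightarrow> 'e \<Rightarrow> 'e \<Rightarrow> 'e" where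
  "curvature_tensor N g p u v w =
     (THE r. \<exists>X Y Z. vector_field N X \<and> vector_field N Y \<and> vector_field N Z \<and>
        X p = u \<and> Y p = v \<and> Z p = w \<and> r = curvature_op N g X Y Z p)"

definition sectional_curvature ::
  "'e::euclidean_space set \<Rightarrow> 'e metric \<Rightarrow> 'e \<Rightarrow> 'e \<Rightarrow> 'e \<Rightarrow> real" where
  "sectional_curvature N g p u v =
     g p (curvature_tensor N g p u v v) u / (g p u u * g p v v - (g p u v)\<^sup>2)"


section \<open>Contact metric and Sasakian structures\<close>

text \<open>Convention for the exterior derivative of a 1-form:
  \<open>d\<eta>(X,Y) = (X(\<eta>(Y)) - Y(\<eta>(X)) - \<eta>([X,Y]))/2\<close>. With this factor the condition
  \<open>d\<eta>(X,Y) = g(X,\<phi>Y)\<close> agrees with the normalisations \<open>\<eta> = \<eta>\<^sub>0/2\<close>, \<open>g = g\<^sub>S/4\<close> below.\<close>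

definition contact_metric_structure ::
  "'e::euclidean_space set \<Rightarrow> ('e \<Rightarrow> 'e) \<Rightarrow> ('e \<Rightarrow> 'e \<Rightarrow> real) \<Rightarrow> ('e \<Rightarrow> 'e \<Rightarrow> 'e) \<Rightarrow> 'e metric \<Rightarrow> bool"
  where
  "contact_metric_structure N \<xi> \<eta> \<phi> g \<longleftrightarrow>
     riemannian_metric N g \<and> vector_field N \<xi> \<and>
     (\<forall>X. vector_field N X \<longrightarrow>
        smooth_map N (\<lambda>p. \<eta> p (X p)) \<and> vector_field N (\<lambda>p. \<phi> p (X p))) \<and>
     (\<forall>p\<in>N. \<forall>u\<in>tangent_space N p. \<forall>v\<in>tangent_space N p. \<forall>a b.
        \<eta> p (a *\<^sub>R u + b *\<^sub>R v) = a * \<eta> p u + b * \<eta> p v \<and>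
        \<phi> p (a *\<^sub>R u + b *\<^sub>R v) = a *\<^sub>R \<phi> p u + b *\<^sub>R \<phi> p v \<and>
        \<phi> p u \<in> tangent_space N p \<and>
        \<phi> p (\<phi> p u) = - u + \<eta> p u *\<^sub>R \<xi> p \<and>
        g p (\<phi> p u) (\<phi> p v) = g p u v - \<eta> p u * \<eta> p v) \<and>
     (\<forall>p\<in>N. \<eta> p (\<xi> p) = 1) \<and>
     (\<forall>X Y. vector_field N X \<and> vector_field N Y \<longrightarrow>
        (\<forall>p\<in>N. (tderiv N (\<lambda>x. \<eta> x (Y x)) p (X p) - tderiv N (\<lambda>x. \<eta> x (X x)) p (Y p)
                  - \<eta> p (lie_bracket N X Y p)) / 2 = g p (X p) (\<phi> p (Y p))))"

definition sasakian_manifold ::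
  "nat \<Rightarrow> 'e::euclidean_space set \<Rightarrow> ('e \<Rightarrow> 'e) \<Rightarrow> ('e \<Rightarrow> 'e \<Rightarrow> real) \<Rightarrow> ('e \<Rightarrow> 'e \<Rightarrow> 'e) \<Rightarrow> 'e metric \<Rightarrow> bool"
  where
  "sasakian_manifold k N \<xi> \<eta> \<phi> g \<longleftrightarrow>
     submanifold k N \<and> contact_metric_structure N \<xi> \<eta> \<phi> g \<and>
     (let D = levi_civita N g in
      \<forall>X Y. vector_field N X \<and> vector_field N Y \<longrightarrow>
        (\<forall>p\<in>N. D X (\<lambda>x. \<phi> x (Y x)) p - \<phi> p (D X Y p) = g p (X p) (Y p) *\<^sub>R \<xi> p - \<eta> p (Y p) *\<^sub>R X p))"

definition constant_phi_curvature ::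
  "'e::euclidean_space set \<Rightarrow> ('e \<Rightarrow> 'e) \<Rightarrow> ('e \<Rightarrow> 'e \<Rightarrow> 'e) \<Rightarrow> 'e metric \<Rightarrow> real \<Rightarrow> bool" where
  "constant_phi_curvature N \<xi> \<phi> g c \<longleftrightarrow>
     (\<forall>p\<in>N. \<forall>u\<in>tangent_space N p. u \<noteq> 0 \<and> g p u (\<xi> p) = 0 \<longrightarrow>
        sectional_curvature N g p u (\<phi> p u) = c)"

definition sasakian_space_form ::
  "nat \<Rightarrow> 'e::euclidean_space set \<Rightarrow> ('e \<Rightarrow> 'e) \<Rightarrow> ('e \<Rightarrow> 'e \<Rightarrow> real) \<Rightarrow> ('e \<Rightarrow> 'e \<Rightarrow> 'e) \<Rightarrow> 'e metric
    \<Rightarrow> real \<Rightarrow> bool"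
  where
  "sasakian_space_form k N \<xi> \<eta> \<phi> g c \<longleftrightarrow>
     sasakian_manifold k N \<xi> \<eta> \<phi> g \<and> constant_phi_curvature N \<xi> \<phi> g c"


section \<open>Sasaki metric and the contact metric structure of the unit tangent bundle\<close>

text \<open>A point of the tangent bundle of a submanifold \<open>M\<close> with metric \<open>h\<close> is a pair
  \<open>Q = (q, v)\<close>; the tangent bundle is itself a subset of the Euclidean space \<open>'a \<times> 'a\<close>.\<close>

definition unit_tangent_bundle :: "'a::euclidean_space set \<Rightarrow> 'a metric \<Rightarrow> ('a \<times> 'a) set" where
  "unit_tangent_bundle M h = {(q, v). q \<in> M \<and> v \<in> tangent_space M q \<and> h q v v = 1}"

definition vertical_lift :: "'a::euclidean_space \<times> 'a \<Rightarrow> 'a \<Rightarrow> 'a \<times> 'a" where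
  "vertical_lift Q X = (0, X)"

text \<open>The horizontal lift of \<open>X\<close> at \<open>(q, v)\<close> is \<open>dV(X) - (\<nabla>\<^sub>X V)\<^sup>v\<close>, where \<open>V\<close> is any vector field
  with \<open>V(q) = v\<close>, regarded as the section \<open>x \<mapsto> (x, V(x))\<close> of the tangent bundle.\<close>

definition horizontal_lift ::
  "'a::euclidean_space set \<Rightarrow> 'a metric \<Rightarrow> 'a \<times> 'a \<Rightarrow> 'a \<Rightarrow> 'a \<times> 'a" where
  "horizontal_lift M h Q X =
     (X, THE w. \<exists>A V. vector_field M A \<and> vector_field M V \<and> A (fst Q) = X \<and> V (fst Q) = snd Q \<and>
           w = tderiv M V (fst Q) X - levi_civita M h A V (fst Q))"

text \<open>A tangent vector \<open>A\<close> of the tangent bundle is uniquely \<open>X\<^sup>h + Y\<^sup>v\<close>. Here \<open>X\<close> is \<open>fst A\<close>,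
  its image under the differential of the projection, and \<open>Y\<close> is the following.\<close>

definition vertical_part ::
  "'a::euclidean_space set \<Rightarrow> 'a metric \<Rightarrow> 'a \<times> 'a \<Rightarrow> 'a \<times> 'a \<Rightarrow> 'a" where
  "vertical_part M h Q A = snd (A - horizontal_lift M h Q (fst A))"

definition sasaki_metric :: "'a::euclidean_space set \<Rightarrow> 'a metric \<Rightarrow> ('a \<times> 'a) metric" where
  "sasaki_metric M h Q A B =
     h (fst Q) (fst A) (fst B) + h (fst Q) (vertical_part M h Q A) (vertical_part M h Q B)"

definition tangent_J ::
  "'a::euclidean_space set \<Rightarrow> 'a metric \<Rightarrow> 'a \<times> 'a \<Rightarrow> 'a \<times> 'a \<Rightarrow> 'a \<times> 'a" where
  "tangent_J M h Q A = vertical_lift Q (fst A) - horizontal_lift M h Q (vertical_part M h Q A)"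

definition xi_bar :: "'a::euclidean_space set \<Rightarrow> 'a metric \<Rightarrow> 'a \<times> 'a \<Rightarrow> 'a \<times> 'a" where
  "xi_bar M h Q = - tangent_J M h Q (vertical_lift Q (snd Q))"

definition eta_bar :: "'a::euclidean_space set \<Rightarrow> 'a metric \<Rightarrow> 'a \<times> 'a \<Rightarrow> 'a \<times> 'a \<Rightarrow> real" where
  "eta_bar M h Q A = (THE r. tangent_J M h Q A - r *\<^sub>R vertical_lift Q (snd Q)
     \<in> tangent_space (unit_tangent_bundle M h) Q)"

definition phi_bar :: "'a::euclidean_space set \<Rightarrow> 'a metric \<Rightarrow> 'a \<times> 'a \<Rightarrow> 'a \<times> 'a \<Rightarrow> 'a \<times> 'a" where
  "phi_bar M h Q A = tangent_J M h Q A - eta_bar M h Q A *\<^sub>R vertical_lift Q (snd Q)"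

definition xi_tilde :: "'a::euclidean_space set \<Rightarrow> 'a metric \<Rightarrow> 'a \<times> 'a \<Rightarrow> 'a \<times> 'a" where
  "xi_tilde M h Q = 2 *\<^sub>R xi_bar M h Q"

definition eta_tilde :: "'a::euclidean_space set \<Rightarrow> 'a metric \<Rightarrow> 'a \<times> 'a \<Rightarrow> 'a \<times> 'a \<Rightarrow> real" where
  "eta_tilde M h Q A = eta_bar M h Q A / 2"

definition phi_tilde :: "'a::euclidean_space set \<Rightarrow> 'a metric \<Rightarrow> 'a \<times> 'a \<Rightarrow> 'a \<times> 'a \<Rightarrow> 'a \<times> 'a" where
  "phi_tilde M h = phi_bar M h"

definition g_cm :: "'a::euclidean_space set \<Rightarrow> 'a metric \<Rightarrow> ('a \<times> 'a) metric" where
  "g_cm M h Q A B = sasaki_metric M h Q A B / 4"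


section \<open>Hopf vector fields\<close>

definition round_metric :: "'a::euclidean_space metric" where
  "round_metric q u v = u \<bullet> v"

definition orthogonal_complex_structure :: "('a::euclidean_space \<Rightarrow> 'a) \<Rightarrow> bool" where
  "orthogonal_complex_structure I \<longleftrightarrow> orthogonal_transformation I \<and> (\<forall>x. I (I x) = - x)"

definition hopf_vector_field :: "('a::euclidean_space \<Rightarrow> 'a) \<Rightarrow> bool" where
  "hopf_vector_field \<xi> \<longleftrightarrow>
     (\<exists>I. orthogonal_complex_structure I \<and> (\<forall>x\<in>sphere 0 1. \<xi> x = I x))"

definition field_image :: "('a::euclidean_space \<Rightarrow> 'a) \<Rightarrow> ('a \<times> 'a) set" where
  "field_image \<xi> = (\<lambda>q. (q, \<xi> q)) ` sphere 0 1"

text \<open>Pitfall: \<open>g\<^sub>c\<^sub>m = g\<^sub>S/4\<close> has the same Levi-Civita connection as \<open>g\<^sub>S\<close> but four times its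
  sectional curvatures. On the image of a Hopf field the \<open>\<phi>\<close>-sections have curvature \<open>5/4\<close> when
  measured with \<open>g\<^sub>S\<close>, and hence \<open>5\<close> when measured with \<open>g\<^sub>c\<^sub>m\<close>, while the Sasakian condition
  holds for \<open>g\<^sub>c\<^sub>m\<close>.\<close>

end

theory Submission
  imports Defs
begin

text \<open>
  The tangent bundle of the sphere lies in \<open>\<real>\<^sup>n \<times> \<real>\<^sup>n\<close>. There the image of the Hopf field
  \<open>q \<mapsto> I q\<close> is the sphere of radius \<open>\<surd>2\<close> in the graph of \<open>I\<close>, and on it the Sasaki metric is the
  Berger metric \<open>u \<bullet> v - \<eta>(u) \<eta>(v) / 4\<close>, where \<open>\<eta>(u) = u \<bullet> I p\<close>. A Berger metric
  \<open>s (u \<bullet> v - c \<eta>(u) \<eta>(v))\<close> on a sphere \<open>\<kappa> |p|\<^sup>2 = 1\<close> has an explicit Levi-Civita connection: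
  the round one minus \<open>c (\<eta> \<otimes> \<psi> + \<psi> \<otimes> \<eta>)\<close>, where \<open>\<psi> u\<close> is the tangential part of \<open>I u\<close>.
  Differentiating it, with the symmetry of second derivatives, gives holomorphic sectional curvature
  \<open>(\<kappa> + 3 c) / s\<close>, which is \<open>5 / 4\<close> for \<open>\<kappa> = 1 / 2\<close>, \<open>c = 1 / 4\<close>, \<open>s = 1\<close>. The round sphere itself is
  the case \<open>\<kappa> = 1\<close>, \<open>c = 0\<close>, \<open>s = 1\<close>, which yields the horizontal lifts.
\<close>

subsection \<open>Smooth maps between Euclidean spaces\<close>

text \<open>Tangent vectors of the image at \<open>(q, I q)\<close> are the pairs
  \<open>(a, I a)\<close> with \<open>a\<close> orthogonal to \<open>q\<close>. As the Hopf field is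
  linear, its ambient derivative is \<open>I a\<close>, and the vertical part is \<open>I a\<close>
  without its component along \<open>q\<close>. This loss affects the single direction
  \<open>I q\<close>, which is why the metric is of Berger type. The connection stays simple because
  \<open>\<psi> u\<close> is orthogonal to \<open>I p\<close>, the direction in which the metric was
  changed: the Koszul formula can be solved without inverting the metric. The obstacle is that
  \<open>levi_civita\<close>, \<open>curvature_tensor\<close>, \<open>horizontal_lift\<close> and
  \<open>eta_bar\<close> are choices by SOME or THE. Each can be computed only after a uniqueness
  proof: of the connection, of the value under change of the extending fields, or of a
  scalar.\<close>

lemma Ck_on_subset: "Ck_on k f U \<Longrightarrow> V \<subseteq> U \<Longrightarrow> Ck_on k f V"
  by (induction k arbitrary: f) (auto intro: continuous_on_subset)

lemma Ck_on_Suc_imp: "Ck_on (Suc k) f U \<Longrightarrow> Ck_on k f U"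
proof (induction k arbitrary: f)
  case 0
  then show ?case
    by (auto intro!: continuous_at_imp_continuous_on differentiable_imp_continuous_within)
next
  case (Suc k)
  then show ?case by (metis Ck_on.simps(2))
qed

lemma frechet_derivative_cong_open:
  assumes "open U" "x \<in> U" "\<And>y. y \<in> U \<Longrightarrow> f y = g y"
  shows "frechet_derivative f (at x) = frechet_derivative g (at x)"
proof -
  have "(f has_derivative f') (at x) \<longleftrightarrow> (g has_derivative f') (at x)" for f'
    using assms has_derivative_transform_within_open[of f f' x UNIV U g]
      has_derivative_transform_within_open[of g f' x UNIV U f] by auto
  then show ?thesis unfolding frechet_derivative_def by simp
qed

lemma Ck_on_cong:
  assumes "open U" "\<And>x. x \<in> U \<Longrightarrow> f x = g x"
  shows "Ck_on k f U \<longleftrightarrow> Ck_on k g U"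
  using assms(2)
proof (induction k arbitrary: f g)
  case 0
  then show ?case by (auto cong: continuous_on_cong)
next
  case (Suc k)
  have "f differentiable (at x) \<longleftrightarrow> g differentiable (at x)" if "x \<in> U" for x
    unfolding differentiable_def
    using Suc.prems assms(1) that has_derivative_transform_within_open[of f _ x UNIV U g]
      has_derivative_transform_within_open[of g _ x UNIV U f] by metis
  moreover have "Ck_on k (\<lambda>x. frechet_derivative f (at x) v) U \<longleftrightarrow>
      Ck_on k (\<lambda>x. frechet_derivative g (at x) v) U" for v
    using Suc.prems by (intro Suc.IH) (simp add: frechet_derivative_cong_open[OF assms(1), of _ f g])
  ultimately show ?case by simp
qed

text \<open>\<open>frechet_derivative\<close> is a chosen derivative; uniqueness of derivatives lets
  any explicit \<open>f'\<close> stand in for it, which is what the inductions below supply.\<close>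

lemma Ck_on_SucI:
  assumes "open U" "\<And>x. x \<in> U \<Longrightarrow> (f has_derivative f' x) (at x)" "\<And>v. Ck_on k (\<lambda>x. f' x v) U"
  shows "Ck_on (Suc k) f U"
proof -
  have "Ck_on k (\<lambda>x. frechet_derivative f (at x) v) U" for v
    using assms(3)[of v] Ck_on_cong[OF assms(1), of "\<lambda>x. frechet_derivative f (at x) v" "\<lambda>x. f' x v"]
    by (metis assms(2) frechet_derivative_at)
  then show ?thesis
    using assms(2) by (auto simp: differentiable_def)
qed

lemma Ck_on_SucD:
  assumes "Ck_on (Suc k) f U"
  shows "x \<in> U \<Longrightarrow> (f has_derivative frechet_derivative f (at x)) (at x)"
    and "Ck_on k (\<lambda>x. frechet_derivative f (at x) v) U"
  using assms by (auto simp: frechet_derivative_works)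

lemma Ck_on_const: "open U \<Longrightarrow> Ck_on k (\<lambda>x. c) U"
proof (induction k arbitrary: c)
  case (Suc k)
  then show ?case
    by (intro Ck_on_SucI[where f' = "\<lambda>x v. 0"]) auto
qed simp

lemma Ck_on_bounded_linear:
  assumes "bounded_linear T" "open U" "Ck_on k f U"
  shows "Ck_on k (\<lambda>x. T (f x)) U"
  using assms(3)
proof (induction k arbitrary: f)
  case 0
  then show ?case by (auto intro: bounded_linear.continuous_on[OF assms(1)])
next
  case (Suc k)
  show ?case
    by (rule Ck_on_SucI[OF assms(2) bounded_linear.has_derivative[OF assms(1) Ck_on_SucD(1)[OF Suc.prems]]])
      (assumption | rule Suc.IH Ck_on_SucD(2)[OF Suc.prems])+
qed

lemma Ck_on_add:
  assumes "open U" "Ck_on k f U" "Ck_on k g U"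
  shows "Ck_on k (\<lambda>x. f x + g x) U"
  using assms(2,3)
proof (induction k arbitrary: f g)
  case 0
  then show ?case by (auto intro: continuous_on_add)
next
  case (Suc k)
  show ?case
    by (rule Ck_on_SucI[OF assms(1) has_derivative_add[OF Ck_on_SucD(1)[OF Suc.prems(1)] Ck_on_SucD(1)[OF Suc.prems(2)]]])
      (assumption | rule Suc.IH Ck_on_SucD(2)[OF Suc.prems(1)] Ck_on_SucD(2)[OF Suc.prems(2)])+
qed

text \<open>Each Leibniz term pairs a derivative with an undifferentiated factor, so the induction
  hypothesis also needs the factors themselves at order \<open>k\<close>;
  \<open>Ck_on_Suc_imp\<close> provides this.\<close>

lemma Ck_on_bounded_bilinear:
  assumes "bounded_bilinear B" "open U" "Ck_on k f U" "Ck_on k g U"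
  shows "Ck_on k (\<lambda>x. B (f x) (g x)) U"
  using assms(3,4)
proof (induction k arbitrary: f g)
  case 0
  then show ?case by (auto intro: bounded_bilinear.continuous_on[OF assms(1)])
next
  case (Suc k)
  show ?case
    by (rule Ck_on_SucI[OF assms(2) bounded_bilinear.FDERIV[OF assms(1) Ck_on_SucD(1)[OF Suc.prems(1)] Ck_on_SucD(1)[OF Suc.prems(2)]]])
      (assumption | rule Ck_on_add Suc.IH assms(2) Ck_on_Suc_imp[OF Suc.prems(1)] Ck_on_Suc_imp[OF Suc.prems(2)]
        Ck_on_SucD(2)[OF Suc.prems(1)] Ck_on_SucD(2)[OF Suc.prems(2)])+
qed

lemma smooth_on_subset: "smooth_on f U \<Longrightarrow> V \<subseteq> U \<Longrightarrow> smooth_on f V"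
  unfolding smooth_on_def by (intro allI Ck_on_subset[of _ f U V]) auto

lemma smooth_on_cong:
  "open U \<Longrightarrow> (\<And>x. x \<in> U \<Longrightarrow> f x = g x) \<Longrightarrow> smooth_on f U \<longleftrightarrow> smooth_on g U"
  using Ck_on_cong[of U f g] by (simp add: smooth_on_def)

lemma smooth_on_const: "open U \<Longrightarrow> smooth_on (\<lambda>x. c) U"
  unfolding smooth_on_def by (simp add: Ck_on_const)

lemma smooth_on_bounded_linear:
  "bounded_linear T \<Longrightarrow> open U \<Longrightarrow> smooth_on f U \<Longrightarrow> smooth_on (\<lambda>x. T (f x)) U"
  by (simp add: smooth_on_def Ck_on_bounded_linear)

lemma smooth_on_id: "open U \<Longrightarrow> smooth_on (\<lambda>x. x) U"
  unfolding smooth_on_def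
proof
  fix k
  assume "open U"
  then show "Ck_on k (\<lambda>x. x) U"
  proof (cases k)
    case (Suc l)
    show ?thesis unfolding Suc
      by (rule Ck_on_SucI[where f' = "\<lambda>x v. v"]) (auto simp: \<open>open U\<close> Ck_on_const)
  qed simp
qed

lemma smooth_on_add:
  "open U \<Longrightarrow> smooth_on f U \<Longrightarrow> smooth_on g U \<Longrightarrow> smooth_on (\<lambda>x. f x + g x) U"
  by (simp add: smooth_on_def Ck_on_add)

lemma smooth_on_bounded_bilinear:
  "bounded_bilinear B \<Longrightarrow> open U \<Longrightarrow> smooth_on f U \<Longrightarrow> smooth_on g U
    \<Longrightarrow> smooth_on (\<lambda>x. B (f x) (g x)) U"
  by (simp add: smooth_on_def Ck_on_bounded_bilinear)

lemma smooth_on_sum: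
  "finite A \<Longrightarrow> open U \<Longrightarrow> (\<And>i. i \<in> A \<Longrightarrow> smooth_on (f i) U) \<Longrightarrow> smooth_on (\<lambda>x. \<Sum>i\<in>A. f i x) U"
  by (induction A rule: finite_induct) (simp_all add: smooth_on_const smooth_on_add)

lemma smooth_on_frechet_derivative:
  "smooth_on f U \<Longrightarrow> smooth_on (\<lambda>x. frechet_derivative f (at x) v) U"
  unfolding smooth_on_def by (intro allI Ck_on_SucD(2)) (rule spec)

lemma smooth_on_has_derivative:
  "smooth_on f U \<Longrightarrow> x \<in> U \<Longrightarrow> (f has_derivative frechet_derivative f (at x)) (at x)"
  unfolding smooth_on_def by (rule Ck_on_SucD(1)[of 0 f U]) auto

lemma smooth_on_continuous_on: "smooth_on f U \<Longrightarrow> continuous_on U f"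
  unfolding smooth_on_def using Ck_on.simps(1)[of f U] by (auto dest: spec[of _ 0])

lemma bounded_linear_frechet_derivative:
  "smooth_on f U \<Longrightarrow> x \<in> U \<Longrightarrow> bounded_linear (frechet_derivative f (at x))"
  by (rule has_derivative_bounded_linear[OF smooth_on_has_derivative])

text \<open>\<open>Ck_on\<close> controls derivatives in fixed directions. The expansion reduces a
  direction that varies with the point to finitely many fixed ones with variable
  coefficients.\<close>

lemma frechet_derivative_Basis_expansion:
  assumes "smooth_on f U" "x \<in> U"
  shows "frechet_derivative f (at x) v = (\<Sum>b\<in>Basis. (v \<bullet> b) *\<^sub>R frechet_derivative f (at x) b)"
proof -
  interpret bounded_linear "frechet_derivative f (at x)"
    by (rule bounded_linear_frechet_derivative[OF assms])
  have "frechet_derivative f (at x) v = frechet_derivative f (at x) (\<Sum>b\<in>Basis. (v \<bullet> b) *\<^sub>R b)"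
    by (simp add: euclidean_representation)
  also have "\<dots> = (\<Sum>b\<in>Basis. (v \<bullet> b) *\<^sub>R frechet_derivative f (at x) b)"
    by (simp add: sum scaleR)
  finally show ?thesis .
qed

lemma smooth_on_frechet_derivative_apply:
  assumes "open U" "smooth_on f U" "smooth_on g U"
  shows "smooth_on (\<lambda>x. frechet_derivative f (at x) (g x)) U"
proof -
  have "smooth_on (\<lambda>x. \<Sum>b\<in>Basis. (g x \<bullet> b) *\<^sub>R frechet_derivative f (at x) b) U"
    by (intro smooth_on_sum finite_Basis assms(1)
        smooth_on_bounded_bilinear[OF bounded_bilinear_scaleR] smooth_on_frechet_derivative assms(2)
        smooth_on_bounded_linear[OF bounded_linear_inner_left] assms(3))
  then show ?thesis
    by (subst smooth_on_cong[OF assms(1) frechet_derivative_Basis_expansion[OF assms(2)]])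
qed

section \<open>Symmetry of second derivatives\<close>

text \<open>The mean value theorem is applied twice: in direction \<open>u\<close> to a difference
  taken in direction \<open>v\<close>, then in direction \<open>v\<close> to the resulting
  derivative.\<close>

lemma second_difference_mean_value:
  fixes f :: "'e::euclidean_space \<Rightarrow> real"
  assumes "smooth_on f (ball p e)" "t > 0" "t * (norm u + norm v) < e"
  obtains q where "dist p q \<le> t * (norm u + norm v)"
    "f (p + t *\<^sub>R u + t *\<^sub>R v) - f (p + t *\<^sub>R u) - f (p + t *\<^sub>R v) + f p =
      t\<^sup>2 * frechet_derivative (\<lambda>x. frechet_derivative f (at x) u) (at q) v"
proof -
  let ?D = "\<lambda>x. frechet_derivative f (at x)"
  let ?DD = "\<lambda>x. frechet_derivative (\<lambda>x. ?D x u) (at x)"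
  have sm: "smooth_on (\<lambda>x. ?D x u) (ball p e)"
    by (rule smooth_on_frechet_derivative[OF assms(1)])
  have near: "norm (a *\<^sub>R u + b *\<^sub>R v) \<le> t * (norm u + norm v)"
    if "0 \<le> a" "a \<le> t" "0 \<le> b" "b \<le> t" for a b
  proof -
    have "norm (a *\<^sub>R u + b *\<^sub>R v) \<le> a * norm u + b * norm v"
      using norm_triangle_ineq[of "a *\<^sub>R u" "b *\<^sub>R v"] that by simp
    also have "\<dots> \<le> t * norm u + t * norm v"
      using that by (intro add_mono mult_right_mono) auto
    finally show ?thesis by (simp add: algebra_simps)
  qed
  have dist_p: "dist p (p + x + y) = norm (x + y)" for x y
  proof -
    have "p - (p + x + y) = - (x + y)" by simp
    then show ?thesis by (metis dist_norm norm_minus_cancel)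
  qed
  have inb: "p + a *\<^sub>R u + b *\<^sub>R v \<in> ball p e" if "0 \<le> a" "a \<le> t" "0 \<le> b" "b \<le> t" for a b
    using near[OF that] assms(3) by (simp add: dist_p)
  have lin: "linear (?D x)" "linear (?DD x)" if "x \<in> ball p e" for x
    using bounded_linear_frechet_derivative[OF assms(1) that] bounded_linear_frechet_derivative[OF sm that]
    by (auto dest: bounded_linear.linear)
  have d1: "((\<lambda>s. f (p + s *\<^sub>R u + b *\<^sub>R v)) has_real_derivative ?D (p + s *\<^sub>R u + b *\<^sub>R v) u) (at s)"
    if "0 \<le> s" "s \<le> t" "0 \<le> b" "b \<le> t" for s b
    unfolding has_field_derivative_def
    by (rule has_derivative_eq_rhs[OF has_derivative_compose[where f = "\<lambda>s. p + s *\<^sub>R u + b *\<^sub>R v" and g = f,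
        OF _ smooth_on_has_derivative[OF assms(1) inb[OF that]]]])
      (auto intro!: derivative_eq_intros simp: linear_cmul[OF lin(1)[OF inb[OF that]]] mult.commute)
  \<comment> \<open>The second difference is \<open>h t - h 0\<close>. The summand
    \<open>0 *\<^sub>R v\<close> gives both terms the shape of \<open>d1\<close>, with
    \<open>b = t\<close> and \<open>b = 0\<close>.\<close>
  define h where "h s = f (p + s *\<^sub>R u + t *\<^sub>R v) - f (p + s *\<^sub>R u + 0 *\<^sub>R v)" for s
  have "\<exists>z. 0 < z \<and> z < t \<and>
      h t - h 0 = (t - 0) * (?D (p + z *\<^sub>R u + t *\<^sub>R v) u - ?D (p + z *\<^sub>R u + 0 *\<^sub>R v) u)"
    unfolding h_def by (rule MVT2) (use assms(2) in \<open>auto intro!: DERIV_diff d1[of _ 0, simplified] d1[of _ t]\<close>)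
  then obtain z where z: "0 < z" "z < t"
      "h t - h 0 = t * (?D (p + z *\<^sub>R u + t *\<^sub>R v) u - ?D (p + z *\<^sub>R u + 0 *\<^sub>R v) u)" by auto
  have d2: "((\<lambda>s. ?D (p + z *\<^sub>R u + s *\<^sub>R v) u) has_real_derivative ?DD (p + z *\<^sub>R u + s *\<^sub>R v) v) (at s)"
    if "0 \<le> s" "s \<le> t" for s
    unfolding has_field_derivative_def
    by (rule has_derivative_eq_rhs[OF has_derivative_compose[where f = "\<lambda>s. p + z *\<^sub>R u + s *\<^sub>R v" and g = "\<lambda>x. ?D x u",
        OF _ smooth_on_has_derivative[OF sm inb]]])
      (use z that in \<open>auto intro!: derivative_eq_intros simp: linear_cmul[OF lin(2)[OF inb]] mult.commute\<close>)
  have "\<exists>y. 0 < y \<and> y < t \<and>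
      ?D (p + z *\<^sub>R u + t *\<^sub>R v) u - ?D (p + z *\<^sub>R u + 0 *\<^sub>R v) u = (t - 0) * ?DD (p + z *\<^sub>R u + y *\<^sub>R v) v"
    by (rule MVT2) (use assms(2) in \<open>auto intro!: d2\<close>)
  then obtain y where y: "0 < y" "y < t"
      "?D (p + z *\<^sub>R u + t *\<^sub>R v) u - ?D (p + z *\<^sub>R u + 0 *\<^sub>R v) u = t * ?DD (p + z *\<^sub>R u + y *\<^sub>R v) v" by auto
  have "h t - h 0 = t\<^sup>2 * ?DD (p + z *\<^sub>R u + y *\<^sub>R v) v"
    using z(3) y(3) by (simp add: power2_eq_square)
  then have "f (p + t *\<^sub>R u + t *\<^sub>R v) - f (p + t *\<^sub>R u) - f (p + t *\<^sub>R v) + f p =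
      t\<^sup>2 * ?DD (p + z *\<^sub>R u + y *\<^sub>R v) v"
    by (simp add: h_def)
  moreover have "dist p (p + z *\<^sub>R u + y *\<^sub>R v) \<le> t * (norm u + norm v)"
    using near[of z y] y z by (simp add: dist_p)
  ultimately show ?thesis using that by blast
qed

text \<open>The second difference is unchanged when \<open>u\<close> and \<open>v\<close> are
  exchanged, so for each step size the two mixed derivatives agree, although at different points.
  Both points tend to \<open>p\<close>, and second derivatives are continuous.\<close>

lemma second_derivative_symmetric_real:
  fixes f :: "'e::euclidean_space \<Rightarrow> real"
  assumes "open U" "smooth_on f U" "p \<in> U"
  shows "frechet_derivative (\<lambda>x. frechet_derivative f (at x) u) (at p) v =
    frechet_derivative (\<lambda>x. frechet_derivative f (at x) v) (at p) u"
proof -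
  let ?H = "\<lambda>u v x. frechet_derivative (\<lambda>x. frechet_derivative f (at x) u) (at x) v"
  obtain e where e: "e > 0" "ball p e \<subseteq> U" using assms openE by blast
  have sm: "smooth_on f (ball p e)" by (rule smooth_on_subset[OF assms(2) e(2)])
  \<comment> \<open>Adding 1 keeps \<open>C\<close> positive when \<open>u = v = 0\<close>; dividing
    by \<open>n + 2\<close> makes \<open>t n * C < e\<close> already for
    \<open>n = 0\<close>.\<close>
  define C where "C = norm u + norm v + 1"
  have "C > 0" unfolding C_def by (simp add: add_nonneg_pos)
  define t where "t n = e / C / real (n + 2)" for n
  have t: "t n > 0" "t n * (norm u + norm v) < e" for n
  proof -
    show "t n > 0" unfolding t_def using e \<open>C > 0\<close> by simp
    have "t n * C = e / real (n + 2)" unfolding t_def using \<open>C > 0\<close> by simp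
    also have "\<dots> < e" using e by (simp add: divide_less_eq)
    finally show "t n * (norm u + norm v) < e"
      using \<open>t n > 0\<close> unfolding C_def by (simp add: algebra_simps)
  qed
  have tlim: "t \<longlonglongrightarrow> 0" unfolding t_def
    using LIMSEQ_ignore_initial_segment[OF lim_const_over_n[of "e / C"], of 2] by simp
  have "\<exists>q. dist p q \<le> t n * (norm u + norm v) \<and>
      f (p + t n *\<^sub>R u + t n *\<^sub>R v) - f (p + t n *\<^sub>R u) - f (p + t n *\<^sub>R v) + f p = (t n)\<^sup>2 * ?H u v q" for n
    using second_difference_mean_value[OF sm t] by metis
  then obtain q where q: "\<And>n. dist p (q n) \<le> t n * (norm u + norm v)"
      "\<And>n. f (p + t n *\<^sub>R u + t n *\<^sub>R v) - f (p + t n *\<^sub>R u) - f (p + t n *\<^sub>R v) + f p = (t n)\<^sup>2 * ?H u v (q n)"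
    by metis
  have "\<exists>q. dist p q \<le> t n * (norm u + norm v) \<and>
      f (p + t n *\<^sub>R v + t n *\<^sub>R u) - f (p + t n *\<^sub>R v) - f (p + t n *\<^sub>R u) + f p = (t n)\<^sup>2 * ?H v u q" for n
    using second_difference_mean_value[OF sm t(1), of n v u] t(2)[of n] by (metis add.commute)
  then obtain q' where q': "\<And>n. dist p (q' n) \<le> t n * (norm u + norm v)"
      "\<And>n. f (p + t n *\<^sub>R v + t n *\<^sub>R u) - f (p + t n *\<^sub>R v) - f (p + t n *\<^sub>R u) + f p = (t n)\<^sup>2 * ?H v u (q' n)"
    by metis
  have eq: "?H u v (q n) = ?H v u (q' n)" for n
  proof -
    have "(t n)\<^sup>2 * ?H u v (q n) = (t n)\<^sup>2 * ?H v u (q' n)"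
      unfolding q(2)[symmetric] q'(2)[symmetric] by (simp add: algebra_simps)
    then show ?thesis using t(1)[of n] by simp
  qed
  have lim: "(\<lambda>n. ?H a b (r n)) \<longlonglongrightarrow> ?H a b p"
    if "\<And>n. dist p (r n) \<le> t n * (norm u + norm v)" for a b r
  proof -
    have "(\<lambda>n. t n * (norm u + norm v)) \<longlonglongrightarrow> 0"
      using tendsto_mult_right[OF tlim, of "norm u + norm v"] by simp
    then have "(\<lambda>n. dist p (r n)) \<longlonglongrightarrow> 0"
      by (rule tendsto_sandwich[OF always_eventually always_eventually tendsto_const, rotated 2]) (use that in auto)
    then have "(\<lambda>n. dist (r n) p) \<longlonglongrightarrow> 0"
      by (simp only: dist_commute)
    then have "r \<longlonglongrightarrow> p"
      by (simp only: tendsto_dist_iff[symmetric])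
    moreover have "smooth_on (?H a b) U"
      by (rule smooth_on_frechet_derivative[OF smooth_on_frechet_derivative[OF assms(2)]])
    then have "isCont (?H a b) p"
      using smooth_on_continuous_on assms(1,3) continuous_on_eq_continuous_at by blast
    ultimately show ?thesis
      using isCont_tendsto_compose[of p "?H a b" r sequentially] by simp
  qed
  have "(\<lambda>n. ?H u v (q n)) \<longlonglongrightarrow> ?H v u p"
    using lim[OF q'(1), of v u] by (simp only: eq)
  then show ?thesis
    by (rule LIMSEQ_unique[OF lim[OF q(1)]])
qed

lemma second_derivative_symmetric:
  fixes f :: "'e::euclidean_space \<Rightarrow> 'f::euclidean_space"
  assumes "open U" "smooth_on f U" "p \<in> U"
  shows "frechet_derivative (\<lambda>x. frechet_derivative f (at x) u) (at p) v =
    frechet_derivative (\<lambda>x. frechet_derivative f (at x) v) (at p) u"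
proof (rule euclidean_eqI)
  fix b :: 'f
  have sm: "smooth_on (\<lambda>x. f x \<bullet> b) U"
    by (rule smooth_on_bounded_linear[OF bounded_linear_inner_left assms(1,2)])
  have comp: "frechet_derivative (\<lambda>x. h x \<bullet> b) (at x) w = frechet_derivative h (at x) w \<bullet> b"
    if "smooth_on h U" "x \<in> U" for h :: "'e \<Rightarrow> 'f" and x w
    using frechet_derivative_at[OF bounded_linear.has_derivative[OF bounded_linear_inner_left
        smooth_on_has_derivative[OF that]], of b] by metis
  have "frechet_derivative (\<lambda>x. frechet_derivative (\<lambda>x. f x \<bullet> b) (at x) w) (at p) w' =
      frechet_derivative (\<lambda>x. frechet_derivative f (at x) w) (at p) w' \<bullet> b" for w w'
  proof -
    have "frechet_derivative (\<lambda>x. frechet_derivative (\<lambda>x. f x \<bullet> b) (at x) w) (at p) =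
        frechet_derivative (\<lambda>x. frechet_derivative f (at x) w \<bullet> b) (at p)"
      by (rule frechet_derivative_cong_open[OF assms(1,3)]) (rule comp[OF assms(2)])
    then show ?thesis
      using comp[OF smooth_on_frechet_derivative[OF assms(2)] assms(3)] by simp
  qed
  then show "frechet_derivative (\<lambda>x. frechet_derivative f (at x) u) (at p) v \<bullet> b =
    frechet_derivative (\<lambda>x. frechet_derivative f (at x) v) (at p) u \<bullet> b"
    using second_derivative_symmetric_real[OF assms(1) sm assms(3)] by metis
qed

subsection \<open>Calculus on submanifolds\<close>

text \<open>Along a curve in \<open>N\<close> with velocity \<open>v\<close> the chain rule holds
  for every derivative within \<open>N\<close>, and the velocity of the image curve is unique. Hence
  all choices of derivative agree on tangent vectors.\<close>

lemma tderiv_eqI: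
  assumes "(f has_derivative f') (at p within N)" "v \<in> tangent_space N p"
  shows "tderiv N f p v = f' v"
proof -
  obtain \<gamma> :: "real \<Rightarrow> 'a" where \<gamma>: "range \<gamma> \<subseteq> N" "\<gamma> 0 = p" "(\<gamma> has_vector_derivative v) (at 0)"
    using assms(2) unfolding tangent_space_def by blast
  have *: "((\<lambda>t. f (\<gamma> t)) has_vector_derivative h v) (at 0)" if h: "(f has_derivative h) (at p within N)" for h
  proof -
    have "(f has_derivative h) (at (\<gamma> 0) within range \<gamma>)"
      using has_derivative_subset[OF h \<gamma>(1)] \<gamma>(2) by simp
    from has_derivative_in_compose[OF \<gamma>(3)[unfolded has_vector_derivative_def] this]
    show ?thesis
      by (simp add: has_vector_derivative_def linear_cmul[OF has_derivative_linear[OF h]])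
  qed
  have "(f has_derivative frechet_derivative f (at p within N)) (at p within N)"
    using assms(1) by (metis differentiableI frechet_derivative_works)
  then show ?thesis
    unfolding tderiv_def using vector_derivative_unique_at[OF * *[OF assms(1)]] by blast
qed

lemma tderiv_cong:
  assumes "\<And>x. x \<in> N \<Longrightarrow> f x = g x" "p \<in> N"
  shows "tderiv N f p = tderiv N g p"
proof -
  have "(f has_derivative h) (at p within N) \<longleftrightarrow> (g has_derivative h) (at p within N)" for h
    using has_derivative_transform[OF assms(2), of f g] has_derivative_transform[OF assms(2), of g f] assms(1)
    by auto
  then show ?thesis
    by (intro ext) (simp add: tderiv_def frechet_derivative_def)
qed

text \<open>The conclusions hold at all points of \<open>N\<close> in \<open>U\<close>, not only at
  \<open>p\<close>: near \<open>p\<close> the derivative of \<open>f\<close> along a field is then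
  expressed by a smooth ambient map and can be differentiated again.\<close>

lemma smooth_map_obtain_extension:
  assumes "smooth_map N f" "p \<in> N"
  obtains U F where "open U" "p \<in> U" "smooth_on F U" "\<And>x. x \<in> U \<Longrightarrow> x \<in> N \<Longrightarrow> F x = f x"
    "\<And>x. x \<in> U \<Longrightarrow> x \<in> N \<Longrightarrow> (f has_derivative frechet_derivative F (at x)) (at x within N)"
    "\<And>x v. x \<in> U \<Longrightarrow> x \<in> N \<Longrightarrow> v \<in> tangent_space N x \<Longrightarrow> tderiv N f x v = frechet_derivative F (at x) v"
proof -
  obtain U F where UF: "open U" "p \<in> U" "smooth_on F U" "\<forall>x\<in>U \<inter> N. F x = f x"
    using bspec[OF assms(1)[unfolded smooth_map_def] assms(2)] by (elim exE conjE)
  have Ff: "F x = f x" if "x \<in> U" "x \<in> N" for x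
    using UF(4) that by simp
  have der: "(f has_derivative frechet_derivative F (at x)) (at x within N)" if "x \<in> U" "x \<in> N" for x
  proof -
    have "(F has_derivative frechet_derivative F (at x)) (at x within N \<inter> U)"
      by (rule has_derivative_at_withinI[OF smooth_on_has_derivative[OF UF(3) that(1)]])
    then have "(f has_derivative frechet_derivative F (at x)) (at x within N \<inter> U)"
      by (rule has_derivative_transform[rotated 2]) (use that Ff in auto)
    moreover have "at x within N \<inter> U = at x within N"
      by (rule at_within_nhd[OF that(1) UF(1)]) auto
    ultimately show ?thesis by simp
  qed
  show ?thesis
    by (rule that[OF UF(1-3) Ff der tderiv_eqI[OF der]])
qed

lemma smooth_map_has_derivative:
  assumes "smooth_map N f" "p \<in> N"
  shows "(f has_derivative tderiv N f p) (at p within N)"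
proof -
  obtain f' where "(f has_derivative f') (at p within N)"
    by (rule smooth_map_obtain_extension[OF assms]) (use assms(2) in blast)
  then have "(f has_derivative frechet_derivative f (at p within N)) (at p within N)"
    by (metis differentiableI frechet_derivative_works)
  then show ?thesis
    by (simp add: tderiv_def[abs_def] eta_contract_eq)
qed

lemma smooth_map_cong:
  assumes "\<And>x. x \<in> N \<Longrightarrow> f x = g x"
  shows "smooth_map N f \<longleftrightarrow> smooth_map N g"
proof -
  have "(\<forall>x\<in>U \<inter> N. F x = f x) \<longleftrightarrow> (\<forall>x\<in>U \<inter> N. F x = g x)" for U F
    using assms by auto
  then show ?thesis by (simp add: smooth_map_def)
qed

lemma smooth_mapI:
  "smooth_on f UNIV \<Longrightarrow> smooth_map N f"
  unfolding smooth_map_def by (intro ballI exI[of _ UNIV] exI[of _ f]) auto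

lemma smooth_map_const [simp]: "smooth_map N (\<lambda>x. c)"
  by (simp add: smooth_mapI smooth_on_const)

lemma smooth_map_id [simp]: "smooth_map N (\<lambda>x. x)"
  by (simp add: smooth_mapI smooth_on_id)

lemma smooth_map_bounded_linear:
  assumes "bounded_linear T" "smooth_map N f"
  shows "smooth_map N (\<lambda>x. T (f x))"
  unfolding smooth_map_def
proof
  fix p
  assume "p \<in> N"
  from this obtain U F where "open U" "p \<in> U" "smooth_on F U" "\<And>x. x \<in> U \<Longrightarrow> x \<in> N \<Longrightarrow> F x = f x"
    by (rule smooth_map_obtain_extension[OF assms(2)]) (rule that; assumption)
  then show "\<exists>U F. open U \<and> p \<in> U \<and> smooth_on F U \<and> (\<forall>x\<in>U \<inter> N. F x = T (f x))"
    by (intro exI[of _ U] exI[of _ "\<lambda>x. T (F x)"]) (simp add: smooth_on_bounded_linear[OF assms(1)])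
qed

lemma smooth_map_obtain_extension2:
  assumes "smooth_map N f" "smooth_map N g" "p \<in> N"
  obtains U F G where "open U" "p \<in> U" "smooth_on F U" "smooth_on G U"
    "\<And>x. x \<in> U \<Longrightarrow> x \<in> N \<Longrightarrow> F x = f x" "\<And>x. x \<in> U \<Longrightarrow> x \<in> N \<Longrightarrow> G x = g x"
    "\<And>x v. x \<in> U \<Longrightarrow> x \<in> N \<Longrightarrow> v \<in> tangent_space N x \<Longrightarrow> tderiv N f x v = frechet_derivative F (at x) v"
proof -
  obtain U F where UF: "open U" "p \<in> U" "smooth_on F U" "\<And>x. x \<in> U \<Longrightarrow> x \<in> N \<Longrightarrow> F x = f x"
    "\<And>x v. x \<in> U \<Longrightarrow> x \<in> N \<Longrightarrow> v \<in> tangent_space N x \<Longrightarrow> tderiv N f x v = frechet_derivative F (at x) v"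
    by (rule smooth_map_obtain_extension[OF assms(1,3)]) (rule that; assumption)
  obtain V G where VG: "open V" "p \<in> V" "smooth_on G V" "\<And>x. x \<in> V \<Longrightarrow> x \<in> N \<Longrightarrow> G x = g x"
    by (rule smooth_map_obtain_extension[OF assms(2,3)]) (rule that; assumption)
  show ?thesis
    by (rule that[of "U \<inter> V" F G]) (use UF VG in \<open>auto intro: smooth_on_subset\<close>)
qed

lemma smooth_map_add:
  assumes "smooth_map N f" "smooth_map N g"
  shows "smooth_map N (\<lambda>x. f x + g x)"
  unfolding smooth_map_def
proof
  fix p
  assume p: "p \<in> N"
  obtain U F G where "open U" "p \<in> U" "smooth_on F U" "smooth_on G U"
    "\<And>x. x \<in> U \<Longrightarrow> x \<in> N \<Longrightarrow> F x = f x" "\<And>x. x \<in> U \<Longrightarrow> x \<in> N \<Longrightarrow> G x = g x"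
    by (rule smooth_map_obtain_extension2[OF assms p]) (rule that; assumption)
  then show "\<exists>U H. open U \<and> p \<in> U \<and> smooth_on H U \<and> (\<forall>x\<in>U \<inter> N. H x = f x + g x)"
    by (intro exI[of _ U] exI[of _ "\<lambda>x. F x + G x"]) (simp add: smooth_on_add)
qed

lemma smooth_map_bounded_bilinear:
  assumes "bounded_bilinear B" "smooth_map N f" "smooth_map N g"
  shows "smooth_map N (\<lambda>x. B (f x) (g x))"
  unfolding smooth_map_def
proof
  fix p
  assume p: "p \<in> N"
  obtain U F G where "open U" "p \<in> U" "smooth_on F U" "smooth_on G U"
    "\<And>x. x \<in> U \<Longrightarrow> x \<in> N \<Longrightarrow> F x = f x" "\<And>x. x \<in> U \<Longrightarrow> x \<in> N \<Longrightarrow> G x = g x"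
    by (rule smooth_map_obtain_extension2[OF assms(2,3) p]) (rule that; assumption)
  then show "\<exists>U H. open U \<and> p \<in> U \<and> smooth_on H U \<and> (\<forall>x\<in>U \<inter> N. H x = B (f x) (g x))"
    by (intro exI[of _ U] exI[of _ "\<lambda>x. B (F x) (G x)"]) (simp add: smooth_on_bounded_bilinear[OF assms(1)])
qed

lemmas smooth_map_scaleR = smooth_map_bounded_bilinear[OF bounded_bilinear_scaleR]
lemmas smooth_map_inner = smooth_map_bounded_bilinear[OF bounded_bilinear_inner]
lemmas smooth_map_mult = smooth_map_bounded_bilinear[OF bounded_bilinear_mult]

lemma smooth_map_uminus: "smooth_map N f \<Longrightarrow> smooth_map N (\<lambda>x. - f x)"
  by (rule smooth_map_bounded_linear[OF bounded_linear_minus[OF bounded_linear_ident]])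

lemma smooth_map_diff: "smooth_map N f \<Longrightarrow> smooth_map N g \<Longrightarrow> smooth_map N (\<lambda>x. f x - g x)"
  using smooth_map_add[OF _ smooth_map_uminus, of N f g] by simp

lemma vector_field_smooth_map: "vector_field N X \<Longrightarrow> smooth_map N X"
  and vector_field_tangent: "vector_field N X \<Longrightarrow> p \<in> N \<Longrightarrow> X p \<in> tangent_space N p"
  unfolding vector_field_def by auto

lemma smooth_map_tderiv:
  assumes "smooth_map N f" "vector_field N X"
  shows "smooth_map N (\<lambda>x. tderiv N f x (X x))"
  unfolding smooth_map_def
proof
  fix p
  assume p: "p \<in> N"
  note X = vector_field_smooth_map[OF assms(2)] vector_field_tangent[OF assms(2)]
  obtain U F G where UFG: "open U" "p \<in> U" "smooth_on F U" "smooth_on G U"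
    "\<And>x. x \<in> U \<Longrightarrow> x \<in> N \<Longrightarrow> F x = f x" "\<And>x. x \<in> U \<Longrightarrow> x \<in> N \<Longrightarrow> G x = X x"
    "\<And>x v. x \<in> U \<Longrightarrow> x \<in> N \<Longrightarrow> v \<in> tangent_space N x \<Longrightarrow> tderiv N f x v = frechet_derivative F (at x) v"
    by (rule smooth_map_obtain_extension2[OF assms(1) X(1) p]) (rule that; assumption)
  then show "\<exists>U H. open U \<and> p \<in> U \<and> smooth_on H U \<and> (\<forall>x\<in>U \<inter> N. H x = tderiv N f x (X x))"
    by (intro exI[of _ U] exI[of _ "\<lambda>x. frechet_derivative F (at x) (G x)"])
      (simp add: smooth_on_frechet_derivative_apply X(2))
qed

text \<open>The product rule for a linear map and a vector that both depend on the point. Basis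
  expansion turns it into the rule for sums of scalar multiples; in the second term the vector is
  frozen at \<open>X p\<close>.\<close>

lemma has_derivative_frechet_derivative_apply:
  fixes F :: "'e::euclidean_space \<Rightarrow> 'f::euclidean_space"
  assumes U: "open U" "smooth_on F U" "p \<in> U" and X: "(X has_derivative X') (at p within N)"
  shows "((\<lambda>x. frechet_derivative F (at x) (X x)) has_derivative
    (\<lambda>v. frechet_derivative F (at p) (X' v) +
         frechet_derivative (\<lambda>x. frechet_derivative F (at x) (X p)) (at p) v)) (at p within N)"
proof -
  let ?D = "\<lambda>x. frechet_derivative F (at x)"
  let ?S = "\<lambda>x w. \<Sum>b\<in>Basis. (w \<bullet> b) *\<^sub>R ?D x b"
  have exp: "?D x w = ?S x w" if "x \<in> U" for x w
    by (rule frechet_derivative_Basis_expansion[OF U(2) that])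
  have Db: "((\<lambda>x. ?D x b) has_derivative frechet_derivative (\<lambda>x. ?D x b) (at p)) (at p)" for b
    by (rule smooth_on_has_derivative[OF smooth_on_frechet_derivative[OF U(2)] U(3)])
  have "((\<lambda>x. ?S x (X p)) has_derivative
      (\<lambda>v. \<Sum>b\<in>Basis. (X p \<bullet> b) *\<^sub>R frechet_derivative (\<lambda>x. ?D x b) (at p) v)) (at p)"
    by (intro has_derivative_sum has_derivative_scaleR_right Db)
  then have *: "((\<lambda>x. ?D x (X p)) has_derivative
      (\<lambda>v. \<Sum>b\<in>Basis. (X p \<bullet> b) *\<^sub>R frechet_derivative (\<lambda>x. ?D x b) (at p) v)) (at p)"
    by (rule has_derivative_transform_within_open[OF _ U(1,3)]) (simp add: exp)
  have 2: "frechet_derivative (\<lambda>x. ?D x (X p)) (at p) v =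
      (\<Sum>b\<in>Basis. (X p \<bullet> b) *\<^sub>R frechet_derivative (\<lambda>x. ?D x b) (at p) v)" for v
    by (simp add: frechet_derivative_at[OF *, symmetric])
  have "((\<lambda>x. ?S x (X x)) has_derivative
      (\<lambda>v. \<Sum>b\<in>Basis. (X p \<bullet> b) *\<^sub>R frechet_derivative (\<lambda>x. ?D x b) (at p) v + (X' v \<bullet> b) *\<^sub>R ?D p b))
      (at p within N)"
    by (intro has_derivative_sum has_derivative_scaleR[OF has_derivative_inner_left[OF X]
        has_derivative_at_withinI[OF Db]])
  then have "((\<lambda>x. ?D x (X x)) has_derivative
      (\<lambda>v. \<Sum>b\<in>Basis. (X p \<bullet> b) *\<^sub>R frechet_derivative (\<lambda>x. ?D x b) (at p) v + (X' v \<bullet> b) *\<^sub>R ?D p b))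
      (at p within N)"
    by (rule has_derivative_transform_within_open[OF _ U(1,3)]) (simp add: exp)
  then show ?thesis
    by (rule has_derivative_eq_rhs) (simp add: 2 exp[OF U(3), of "X' v" for v] sum.distrib add.commute)
qed

text \<open>In ambient terms each iterated derivative is a first derivative of \<open>F\<close> plus
  a Hessian. The Hessians cancel by symmetry, and the first derivatives combine to the one along the
  bracket, whose tangency permits the return from \<open>F\<close> to \<open>f\<close>.\<close>

lemma tderiv_lie_bracket:
  fixes f :: "'e::euclidean_space \<Rightarrow> 'f::euclidean_space"
  assumes X: "vector_field N X" and Y: "vector_field N Y" and f: "smooth_map N f" and p: "p \<in> N"
    and tan: "lie_bracket N X Y p \<in> tangent_space N p"
  shows "tderiv N (\<lambda>x. tderiv N f x (Y x)) p (X p) - tderiv N (\<lambda>x. tderiv N f x (X x)) p (Y p) =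
    tderiv N f p (lie_bracket N X Y p)"
proof -
  obtain U F where UF: "open U" "p \<in> U" "smooth_on F U"
    "\<And>x v. x \<in> U \<Longrightarrow> x \<in> N \<Longrightarrow> v \<in> tangent_space N x \<Longrightarrow> tderiv N f x v = frechet_derivative F (at x) v"
    by (rule smooth_map_obtain_extension[OF f p]) (rule that; assumption)
  have one: "tderiv N (\<lambda>x. tderiv N f x (Y x)) p (X p) = frechet_derivative F (at p) (tderiv N Y p (X p)) +
         frechet_derivative (\<lambda>x. frechet_derivative F (at x) (Y p)) (at p) (X p)"
    if X: "vector_field N X" and Y: "vector_field N Y" for X Y
  proof (rule tderiv_eqI)
    show "X p \<in> tangent_space N p" by (rule vector_field_tangent[OF X p])
    have "(Y has_derivative tderiv N Y p) (at p within N)"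
      by (rule smooth_map_has_derivative[OF vector_field_smooth_map[OF Y] p])
    then have "((\<lambda>x. frechet_derivative F (at x) (Y x)) has_derivative
      (\<lambda>v. frechet_derivative F (at p) (tderiv N Y p v) +
         frechet_derivative (\<lambda>x. frechet_derivative F (at x) (Y p)) (at p) v)) (at p within N \<inter> U)"
      by (intro has_derivative_frechet_derivative_apply[OF UF(1,3,2)]) (rule has_derivative_subset[OF _ Int_lower1])
    then have "((\<lambda>x. tderiv N f x (Y x)) has_derivative
      (\<lambda>v. frechet_derivative F (at p) (tderiv N Y p v) +
         frechet_derivative (\<lambda>x. frechet_derivative F (at x) (Y p)) (at p) v)) (at p within N \<inter> U)"
      by (rule has_derivative_transform[rotated 2]) (use p UF Y in \<open>auto simp: vector_field_def\<close>)
    moreover have "at p within N \<inter> U = at p within N"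
      by (rule at_within_nhd[OF UF(2,1)]) auto
    ultimately show "((\<lambda>x. tderiv N f x (Y x)) has_derivative
      (\<lambda>v. frechet_derivative F (at p) (tderiv N Y p v) +
         frechet_derivative (\<lambda>x. frechet_derivative F (at x) (Y p)) (at p) v)) (at p within N)" by simp
  qed
  have lin: "linear (frechet_derivative F (at p))"
    using bounded_linear_frechet_derivative[OF UF(3,2)] by (rule bounded_linear.linear)
  show ?thesis
    unfolding one[OF X Y] one[OF Y X] UF(4)[OF UF(2) p tan]
    using second_derivative_symmetric[OF UF(1,3,2), of "X p" "Y p"]
    by (simp add: lie_bracket_def linear_diff[OF lin])
qed

section \<open>Riemannian metrics and uniqueness of the Levi-Civita connection\<close>

lemma riemannian_metric_diff_left:
  assumes "riemannian_metric N g" "p \<in> N" "u \<in> tangent_space N p" "v \<in> tangent_space N p" "w \<in> tangent_space N p"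
  shows "g p (u - v) w = g p u w - g p v w"
proof -
  have "g p (1 *\<^sub>R u + (-1) *\<^sub>R v) w = 1 * g p u w + (-1) * g p v w"
    using assms by (auto simp only: riemannian_metric_def)
  then show ?thesis by simp
qed

lemma riemannian_metric_commute:
  assumes "riemannian_metric N g" "p \<in> N" "u \<in> tangent_space N p" "v \<in> tangent_space N p"
  shows "g p u v = g p v u"
  using assms by (auto simp only: riemannian_metric_def)

lemma riemannian_metric_pos:
  assumes "riemannian_metric N g" "p \<in> N" "u \<in> tangent_space N p" "u \<noteq> 0"
  shows "g p u u > 0"
  using assms(1)[unfolded riemannian_metric_def, THEN conjunct1, THEN bspec, OF assms(2),
      THEN bspec, OF assms(3), THEN bspec, OF assms(3), THEN bspec, OF assms(3)] assms(4) by blast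

lemma levi_civita_vector_field:
  "is_levi_civita N g D \<Longrightarrow> vector_field N X \<Longrightarrow> vector_field N Y \<Longrightarrow> vector_field N (D X Y)"
  by (simp add: is_levi_civita_def affine_connection_def)

lemma levi_civita_cong:
  assumes "is_levi_civita N g D" "vector_field N X" "vector_field N X'" "vector_field N Y" "vector_field N Y'"
    "\<And>x. x \<in> N \<Longrightarrow> X x = X' x" "\<And>x. x \<in> N \<Longrightarrow> Y x = Y' x" "p \<in> N"
  shows "D X Y p = D X' Y' p"
proof -
  have "\<forall>X X' Y Y'. vector_field N X \<and> vector_field N X' \<and> vector_field N Y \<and> vector_field N Y' \<and>
        (\<forall>p\<in>N. X p = X' p \<and> Y p = Y' p) \<longrightarrow> (\<forall>p\<in>N. D X Y p = D X' Y' p)"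
    using assms(1)[unfolded is_levi_civita_def affine_connection_def] by (elim conjE)
  from this[rule_format, of X X' Y Y' p] show ?thesis using assms by simp
qed

lemma levi_civita_torsion_free:
  "is_levi_civita N g D \<Longrightarrow> vector_field N X \<Longrightarrow> vector_field N Y \<Longrightarrow> p \<in> N \<Longrightarrow>
    D X Y p - D Y X p = lie_bracket N X Y p"
  by (simp add: is_levi_civita_def)

lemma levi_civita_metric:
  "is_levi_civita N g D \<Longrightarrow> vector_field N X \<Longrightarrow> vector_field N Y \<Longrightarrow> vector_field N Z \<Longrightarrow> p \<in> N \<Longrightarrow>
    tderiv N (\<lambda>x. g x (Y x) (Z x)) p (X p) = g p (D X Y p) (Z p) + g p (Y p) (D X Z p)"
  by (simp add: is_levi_civita_def)

text \<open>The difference of two torsion-free metric connections is a tensor that is symmetric in its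
  arguments and skew in the last two slots, hence zero.\<close>

lemma levi_civita_unique:
  assumes g: "riemannian_metric N g" and sub: "\<And>p. p \<in> N \<Longrightarrow> subspace (tangent_space N p)"
    and D: "is_levi_civita N g D" and E: "is_levi_civita N g E"
    and X: "vector_field N X" and Y: "vector_field N Y" and p: "p \<in> N"
  shows "D X Y p = E X Y p"
proof -
  note DE = levi_civita_vector_field[OF D] levi_civita_vector_field[OF E]
  define A where "A X Y x = D X Y x - E X Y x" for X Y x
  have A: "vector_field N (A X Y)" if "vector_field N X" "vector_field N Y" for X Y
    using DE[OF that] sub unfolding vector_field_def A_def
    by (simp add: smooth_map_diff subspace_diff)
  have sym: "A X Y p = A Y X p" if "vector_field N X" "vector_field N Y" for X Y
  proof -
    have "D X Y p - D Y X p = E X Y p - E Y X p"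
      using levi_civita_torsion_free[OF D that p] levi_civita_torsion_free[OF E that p] by simp
    then show ?thesis unfolding A_def by (simp add: algebra_simps)
  qed
  have skew: "g p (A X Y p) (Z p) = - g p (A X Z p) (Y p)"
    if XYZ: "vector_field N X" "vector_field N Y" "vector_field N Z" for X Y Z
  proof -
    note tan = vector_field_tangent[OF _ p]
    have "g p (D X Y p) (Z p) + g p (Y p) (D X Z p) = g p (E X Y p) (Z p) + g p (Y p) (E X Z p)"
      using levi_civita_metric[OF D XYZ p] levi_civita_metric[OF E XYZ p] by simp
    moreover have "g p (Y p) (D X Z p) = g p (D X Z p) (Y p)" "g p (Y p) (E X Z p) = g p (E X Z p) (Y p)"
      using XYZ by (simp_all add: riemannian_metric_commute[OF g p] tan DE)
    moreover have "g p (A X Y p) (Z p) = g p (D X Y p) (Z p) - g p (E X Y p) (Z p)"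
      "g p (A X Z p) (Y p) = g p (D X Z p) (Y p) - g p (E X Z p) (Y p)"
      unfolding A_def using XYZ by (simp_all add: riemannian_metric_diff_left[OF g p] tan DE)
    ultimately show ?thesis by simp
  qed
  \<comment> \<open>Three uses of skewness alternating with three of symmetry bring the product back
    to itself with the opposite sign; with this \<open>Z\<close> the product is a squared
    length.\<close>
  let ?Z = "A X Y"
  note Z = A[OF X Y]
  have "g p (A X Y p) (?Z p) = - g p (A X ?Z p) (Y p)" by (rule skew[OF X Y Z])
  also have "\<dots> = - g p (A ?Z X p) (Y p)" by (simp add: sym[OF X Z])
  also have "\<dots> = g p (A ?Z Y p) (X p)" by (simp add: skew[OF Z X Y])
  also have "\<dots> = g p (A Y ?Z p) (X p)" by (simp add: sym[OF Z Y])
  also have "\<dots> = - g p (A Y X p) (?Z p)" by (rule skew[OF Y Z X])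
  also have "\<dots> = - g p (A X Y p) (?Z p)" by (simp add: sym[OF X Y])
  finally have "g p (?Z p) (?Z p) = 0" by simp
  then have "?Z p = 0"
    using riemannian_metric_pos[OF g p vector_field_tangent[OF Z p]] by fastforce
  then show ?thesis by (simp add: A_def)
qed

lemma tderiv_linear: "smooth_map N f \<Longrightarrow> p \<in> N \<Longrightarrow> linear (tderiv N f p)"
  by (rule has_derivative_linear[OF smooth_map_has_derivative])

lemma tderiv_add:
  assumes "smooth_map N f" "smooth_map N h" "p \<in> N" "v \<in> tangent_space N p"
  shows "tderiv N (\<lambda>x. f x + h x) p v = tderiv N f p v + tderiv N h p v"
  by (rule tderiv_eqI[OF has_derivative_add[OF smooth_map_has_derivative[OF assms(1,3)]
      smooth_map_has_derivative[OF assms(2,3)]] assms(4)])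

lemma tderiv_scaleR:
  assumes "smooth_map N f" "smooth_map N h" "p \<in> N" "v \<in> tangent_space N p"
  shows "tderiv N (\<lambda>x. f x *\<^sub>R h x) p v = tderiv N f p v *\<^sub>R h p + f p *\<^sub>R tderiv N h p v"
  by (subst tderiv_eqI[OF has_derivative_scaleR[OF smooth_map_has_derivative[OF assms(1,3)]
      smooth_map_has_derivative[OF assms(2,3)]] assms(4)]) (simp add: add.commute)

subsection \<open>Berger spheres\<close>

text \<open>The complex linear subspace containing the sphere is encoded as the fixed space of \<open>P\<close>.\<close>

locale complex_sphere =
  fixes I P :: "'e::euclidean_space \<Rightarrow> 'e" and \<kappa> :: real
  assumes linear_I: "linear I" and I_I [simp]: "I (I x) = - x" and I_inner_I: "I x \<bullet> I y = x \<bullet> y"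
    and linear_P: "linear P" and P_I: "P (I x) = I (P x)" and \<kappa>_pos: "\<kappa> > 0"
begin

definition N :: "'e set" where
  "N = {p. P p = p \<and> \<kappa> * (p \<bullet> p) = 1}"

lemmas I_simps [simp] = linear_0[OF linear_I] linear_add[OF linear_I] linear_diff[OF linear_I]
  linear_neg[OF linear_I] linear_cmul[OF linear_I]
lemmas P_simps [simp] = linear_0[OF linear_P] linear_add[OF linear_P] linear_diff[OF linear_P]
  linear_neg[OF linear_P] linear_cmul[OF linear_P]

lemma bounded_linear_I: "bounded_linear I" and bounded_linear_P: "bounded_linear P"
  using linear_I linear_P by (simp_all add: linear_conv_bounded_linear)

lemma I_skew: "I u \<bullet> v = - (u \<bullet> I v)"
  using I_inner_I[of "I u" v] by simp

lemma inner_I_self: "x \<bullet> I x = 0"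
  using I_skew[of x x] by (simp add: inner_commute)

lemma inner_I_swap: "u \<bullet> I v = - (v \<bullet> I u)"
  using I_skew[of u v] by (simp add: inner_commute)

text \<open>One inclusion differentiates the two defining equations along a curve. For the other, a
  circle through \<open>p\<close> about the origin, in the plane of \<open>p\<close> and
  \<open>v\<close>, has velocity \<open>v\<close>.\<close>

lemma tangent_space_N:
  assumes p: "p \<in> N"
  shows "tangent_space N p = {v. P v = v \<and> v \<bullet> p = 0}"
proof (intro equalityI subsetI)
  fix v
  assume "v \<in> tangent_space N p"
  then obtain \<gamma> :: "real \<Rightarrow> 'e" where \<gamma>: "range \<gamma> \<subseteq> N" "\<gamma> 0 = p" "(\<gamma> has_vector_derivative v) (at 0)"
    unfolding tangent_space_def by blast
  have d: "(\<gamma> has_derivative (\<lambda>t. t *\<^sub>R v)) (at 0)"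
    using \<gamma>(3) by (simp add: has_vector_derivative_def)
  have mem: "P (\<gamma> t) = \<gamma> t" "\<kappa> * (\<gamma> t \<bullet> \<gamma> t) = 1" for t
    using \<gamma>(1) by (auto simp: N_def)
  have "((\<lambda>t. P (\<gamma> t)) has_vector_derivative P v) (at 0)"
    by (rule bounded_linear.has_vector_derivative[OF bounded_linear_P \<gamma>(3)])
  then have "(\<gamma> has_vector_derivative P v) (at 0)"
    by (simp only: mem(1))
  then have "P v = v"
    by (rule vector_derivative_unique_at[OF _ \<gamma>(3)])
  have "((\<lambda>t. \<kappa> * (\<gamma> t \<bullet> \<gamma> t)) has_derivative
      (\<lambda>t. \<kappa> * (\<gamma> 0 \<bullet> (t *\<^sub>R v) + (t *\<^sub>R v) \<bullet> \<gamma> 0))) (at 0)"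
    by (rule has_derivative_mult_right[OF has_derivative_inner[OF d d]])
  then have "((\<lambda>t. 1 :: real) has_derivative
      (\<lambda>t. \<kappa> * (\<gamma> 0 \<bullet> (t *\<^sub>R v) + (t *\<^sub>R v) \<bullet> \<gamma> 0))) (at 0)"
    by (simp only: mem(2))
  from has_derivative_unique[OF this has_derivative_const]
  have "(\<lambda>t. \<kappa> * (\<gamma> 0 \<bullet> (t *\<^sub>R v) + (t *\<^sub>R v) \<bullet> \<gamma> 0)) = (\<lambda>t. 0)" .
  from fun_cong[OF this, of 1] have "v \<bullet> p = 0"
    using \<kappa>_pos by (simp add: inner_commute \<gamma>(2))
  with \<open>P v = v\<close> show "v \<in> {v. P v = v \<and> v \<bullet> p = 0}" by simp
next
  fix v
  assume "v \<in> {v. P v = v \<and> v \<bullet> p = 0}"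
  then have v: "P v = v" "v \<bullet> p = 0" by auto
  have Pp: "P p = p" "\<kappa> * (p \<bullet> p) = 1" using p by (auto simp: N_def)
  \<comment> \<open>The angular speed: it makes \<open>v / k\<close> as long as \<open>p\<close>. It
    vanishes for \<open>v = 0\<close>, where a constant curve serves instead.\<close>
  define k where "k = sqrt \<kappa> * norm v"
  show "v \<in> tangent_space N p"
  proof (cases "v = 0")
    case True
    then show ?thesis
      unfolding tangent_space_def using p
      by (intro CollectI exI[of _ "\<lambda>t::real. p"]) auto
  next
    case False
    then have k: "k \<noteq> 0" "k * k = \<kappa> * (v \<bullet> v)"
      using \<kappa>_pos by (auto simp: k_def dot_square_norm power2_eq_square)
    define \<gamma> where "\<gamma> t = cos (k * t) *\<^sub>R p + (sin (k * t) / k) *\<^sub>R v" for t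
    have "\<gamma> t \<in> N" for t
    proof -
      have "\<kappa> * (\<gamma> t \<bullet> \<gamma> t) = (cos (k * t))\<^sup>2 * (\<kappa> * (p \<bullet> p)) + (sin (k * t) / k)\<^sup>2 * (\<kappa> * (v \<bullet> v))"
        using v(2) by (simp add: \<gamma>_def inner_add_left inner_add_right power2_eq_square algebra_simps inner_commute)
      also have "\<dots> = 1"
        unfolding Pp(2) k(2)[symmetric] using k(1) by (simp add: power2_eq_square[symmetric] power_divide)
      finally show ?thesis by (simp add: N_def \<gamma>_def Pp v)
    qed
    moreover have "(\<gamma> has_vector_derivative v) (at 0)"
      unfolding \<gamma>_def has_vector_derivative_def
      using k(1) by (auto intro!: derivative_eq_intros)
    ultimately show ?thesis
      unfolding tangent_space_def by (intro CollectI exI[of _ \<gamma>]) (auto simp: \<gamma>_def)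
  qed
qed

lemma tangent_spaceD:
  assumes "p \<in> N" "v \<in> tangent_space N p"
  shows "P v = v" "v \<bullet> p = 0" "p \<bullet> v = 0"
  using assms by (auto simp: tangent_space_N inner_commute)

lemma subspace_tangent_space_N: "p \<in> N \<Longrightarrow> subspace (tangent_space N p)"
  by (simp add: tangent_space_N subspace_def inner_add_left)

lemma vector_field_iff:
  "vector_field N X \<longleftrightarrow> smooth_map N X \<and> (\<forall>p\<in>N. P (X p) = X p \<and> X p \<bullet> p = 0)"
  by (auto simp: vector_field_def tangent_space_N)

lemma I_point_tangent: "p \<in> N \<Longrightarrow> I p \<in> tangent_space N p"
  by (simp add: tangent_space_N P_I I_skew inner_I_self) (simp add: N_def)

lemma smooth_map_I: "smooth_map A f \<Longrightarrow> smooth_map A (\<lambda>x. I (f x))"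
  by (rule smooth_map_bounded_linear[OF bounded_linear_I])

lemmas smooth_map_intros = smooth_map_const smooth_map_id smooth_map_add smooth_map_diff
  smooth_map_uminus smooth_map_scaleR smooth_map_inner smooth_map_mult smooth_map_I

text \<open>The tangential part of the constant vector \<open>z\<close>, since
  \<open>x \<bullet> x = 1 / \<kappa>\<close> on the sphere. It extends a tangent vector to a global
  field, as the definitions by THE require for a witness.\<close>

definition extension :: "'e \<Rightarrow> 'e \<Rightarrow> 'e" where
  "extension z x = z - (\<kappa> * (z \<bullet> x)) *\<^sub>R x"

lemma vector_field_extension:
  assumes "P z = z"
  shows "vector_field N (extension z)"
proof -
  have "smooth_map N (\<lambda>x. z - (\<kappa> * (z \<bullet> x)) *\<^sub>R x)"
    by (intro smooth_map_intros)
  then have "smooth_map N (extension z)"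
    by (simp add: extension_def[abs_def])
  moreover have "P (extension z p) = extension z p \<and> extension z p \<bullet> p = 0" if "p \<in> N" for p
    using that assms by (simp add: extension_def N_def inner_diff_left)
  ultimately show ?thesis by (simp add: vector_field_iff)
qed

lemma extension_point: "p \<in> N \<Longrightarrow> z \<in> tangent_space N p \<Longrightarrow> extension z p = z"
  by (simp add: extension_def tangent_spaceD)

text \<open>Both identities come from differentiating \<open>P (Y x) = Y x\<close> and
  \<open>Y x \<bullet> x = 0\<close> along the sphere. The second is the normal component that a
  connection has to remove.\<close>

lemma tderiv_vector_field:
  assumes Y: "vector_field N Y" and p: "p \<in> N" and u: "u \<in> tangent_space N p"
  shows "P (tderiv N Y p u) = tderiv N Y p u" "tderiv N Y p u \<bullet> p = - (Y p \<bullet> u)"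
proof -
  note Y' = smooth_map_has_derivative[OF vector_field_smooth_map[OF Y] p]
  have "P (tderiv N Y p u) = tderiv N (\<lambda>x. P (Y x)) p u"
    by (rule tderiv_eqI[OF bounded_linear.has_derivative[OF bounded_linear_P Y'] u, symmetric])
  also have "\<dots> = tderiv N Y p u"
    by (subst tderiv_cong[of N "\<lambda>x. P (Y x)" Y]) (use Y p in \<open>auto simp: vector_field_iff\<close>)
  finally show "P (tderiv N Y p u) = tderiv N Y p u" .
  have "Y p \<bullet> u + tderiv N Y p u \<bullet> p = tderiv N (\<lambda>x. Y x \<bullet> x) p u"
    by (rule tderiv_eqI[OF has_derivative_inner[OF Y' has_derivative_ident] u, symmetric])
  also have "\<dots> = tderiv N (\<lambda>x. 0) p u"
    by (subst tderiv_cong[of N "\<lambda>x. Y x \<bullet> x" "\<lambda>x. 0"]) (use Y p in \<open>auto simp: vector_field_iff\<close>)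
  also have "\<dots> = 0"
    by (rule tderiv_eqI[OF has_derivative_const u])
  finally show "tderiv N Y p u \<bullet> p = - (Y p \<bullet> u)" by simp
qed

end

section \<open>Berger metrics and their Levi-Civita connection\<close>

text \<open>The bound \<open>c < \<kappa>\<close> is positivity: in direction \<open>I p\<close> the
  metric is scaled by \<open>1 - c * (p \<bullet> p)\<close>, and
  \<open>p \<bullet> p = 1 / \<kappa>\<close>. The metric is prescribed on tangent vectors only, so
  that \<open>sasaki_metric\<close> and \<open>g_cm\<close> fit unchanged.\<close>

locale berger_sphere = complex_sphere I P \<kappa>
  for I P :: "'e::euclidean_space \<Rightarrow> 'e" and \<kappa> :: real +
  fixes c s :: real and g :: "'e metric"
  assumes c: "0 \<le> c" "c < \<kappa>" and s_pos: "s > 0"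
    and g_eq: "p \<in> N \<Longrightarrow> u \<in> tangent_space N p \<Longrightarrow> v \<in> tangent_space N p \<Longrightarrow>
      g p u v = s * (u \<bullet> v - c * (u \<bullet> I p) * (v \<bullet> I p))"
begin

lemma g_pos:
  assumes p: "p \<in> N" and u: "u \<in> tangent_space N p" "u \<noteq> 0"
  shows "g p u u > 0"
proof -
  have "c * (u \<bullet> I p)\<^sup>2 \<le> c * ((u \<bullet> u) * (I p \<bullet> I p))"
    by (intro mult_left_mono Cauchy_Schwarz_ineq c)
  also have "\<dots> = (u \<bullet> u) * (c * (p \<bullet> p))" by (simp add: I_inner_I)
  also have "\<dots> < (u \<bullet> u) * 1"
  proof (rule mult_strict_left_mono)
    have "p \<bullet> p > 0" "\<kappa> * (p \<bullet> p) = 1" using p by (auto simp: N_def)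
    then show "c * (p \<bullet> p) < 1"
      using mult_strict_right_mono[OF c(2), of "p \<bullet> p"] by simp
  qed (use u in simp)
  finally show ?thesis
    using s_pos by (simp add: g_eq p u power2_eq_square mult.assoc)
qed

lemma smooth_map_g:
  assumes "vector_field N X" "vector_field N Y"
  shows "smooth_map N (\<lambda>p. g p (X p) (Y p))"
proof -
  have "smooth_map N (\<lambda>p. s * (X p \<bullet> Y p - c * (X p \<bullet> I p) * (Y p \<bullet> I p)))"
    by (intro smooth_map_intros vector_field_smooth_map assms)
  then show ?thesis
    by (subst smooth_map_cong[OF g_eq]) (use assms in \<open>auto intro: vector_field_tangent\<close>)
qed

lemma riemannian_metric_g: "riemannian_metric N g"
  unfolding riemannian_metric_def
proof (intro conjI ballI allI impI)
  fix p u v w a b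
  assume p: "p \<in> N" and t: "u \<in> tangent_space N p" "v \<in> tangent_space N p" "w \<in> tangent_space N p"
  show "g p u v = g p v u" using p t by (simp add: g_eq inner_commute mult_ac)
  have "a *\<^sub>R u + b *\<^sub>R v \<in> tangent_space N p"
    using subspace_tangent_space_N[OF p] t by (simp add: subspace_add subspace_scale)
  then show "g p (a *\<^sub>R u + b *\<^sub>R v) w = a * g p u w + b * g p v w"
    using p t by (simp add: g_eq inner_add_left algebra_simps)
qed (auto intro: g_pos smooth_map_g)

text \<open>Obtained from \<open>\<kappa> (u \<bullet> v) p - c (\<eta>(u) \<psi> v + \<eta>(v) \<psi> u)\<close> by inserting
  \<open>\<psi> u = I u + \<kappa> \<eta>(u) p\<close>; the first term is the one of the round metric.\<close>

definition B :: "'e \<Rightarrow> 'e \<Rightarrow> 'e \<Rightarrow> 'e" where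
  "B p u v = (\<kappa> * (u \<bullet> v) - 2 * c * \<kappa> * (u \<bullet> I p) * (v \<bullet> I p)) *\<^sub>R p
     - (c * (u \<bullet> I p)) *\<^sub>R I v - (c * (v \<bullet> I p)) *\<^sub>R I u"

definition conn :: "'e connection" where
  "conn X Y p = tderiv N Y p (X p) + B p (X p) (Y p)"

lemma B_add_left: "B p (u + u') v = B p u v + B p u' v"
  and B_add_right: "B p u (v + v') = B p u v + B p u v'"
  and B_diff_left: "B p (u - u') v = B p u v - B p u' v"
  and B_scaleR_left: "B p (a *\<^sub>R u) v = a *\<^sub>R B p u v"
  and B_scaleR_right: "B p u (a *\<^sub>R v) = a *\<^sub>R B p u v"
  by (simp_all add: B_def inner_add_left inner_add_right inner_diff_left algebra_simps)

lemma B_commute: "B p u v = B p v u"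
  by (simp add: B_def inner_commute algebra_simps)

lemma B_inner_tangent:
  "w \<bullet> p = 0 \<Longrightarrow> B p u v \<bullet> w = - c * (u \<bullet> I p) * (I v \<bullet> w) - c * (v \<bullet> I p) * (I u \<bullet> w)"
  by (simp add: B_def inner_diff_left inner_commute[of p w])

lemma smooth_map_B:
  "smooth_map N X \<Longrightarrow> smooth_map N Y \<Longrightarrow> smooth_map N (\<lambda>x. B x (X x) (Y x))"
  unfolding B_def by (intro smooth_map_intros)

lemma vector_field_conn:
  assumes X: "vector_field N X" and Y: "vector_field N Y"
  shows "vector_field N (conn X Y)"
  unfolding vector_field_iff
proof (intro conjI ballI)
  have "smooth_map N (\<lambda>p. tderiv N Y p (X p) + B p (X p) (Y p))"
    by (intro smooth_map_add smooth_map_tderiv smooth_map_B vector_field_smooth_map X Y)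
  then show "smooth_map N (conn X Y)" by (simp add: conn_def[abs_def])
  fix p
  assume p: "p \<in> N"
  then have pp: "P p = p" "\<kappa> * (p \<bullet> p) = 1" by (auto simp: N_def)
  note Xp = tangent_spaceD[OF p vector_field_tangent[OF X p]]
  note Yp = tangent_spaceD[OF p vector_field_tangent[OF Y p]]
  note dY = tderiv_vector_field[OF Y p vector_field_tangent[OF X p]]
  show "P (conn X Y p) = conn X Y p"
    by (simp add: conn_def B_def dY P_I Xp Yp pp)
  \<comment> \<open>The last term comes from the two summands with \<open>I\<close> and cancels the
    \<open>2 * c\<close> part of the coefficient of \<open>p\<close>. What remains is
    \<open>X p \<bullet> Y p\<close>, the opposite of the normal component of the
    derivative.\<close>
  have "B p (X p) (Y p) \<bullet> p = (X p \<bullet> Y p - 2 * c * (X p \<bullet> I p) * (Y p \<bullet> I p)) * (\<kappa> * (p \<bullet> p))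
     + 2 * c * (X p \<bullet> I p) * (Y p \<bullet> I p)"
    by (simp add: B_def inner_diff_left I_skew algebra_simps)
  then show "conn X Y p \<bullet> p = 0"
    by (simp add: conn_def inner_add_left dY pp) (simp add: inner_commute)
qed

lemma affine_connection_conn: "affine_connection N conn"
  unfolding affine_connection_def
proof (intro conjI allI impI ballI; (elim conjE)?)
  fix X Y
  assume "vector_field N X" "vector_field N Y"
  then show "vector_field N (conn X Y)" by (rule vector_field_conn)
next
  fix X X' Y Y' :: "'e \<Rightarrow> 'e" and p
  assume eq: "\<forall>p\<in>N. X p = X' p \<and> Y p = Y' p" and p: "p \<in> N"
  have "tderiv N Y p = tderiv N Y' p" by (rule tderiv_cong) (use eq p in auto)
  then show "conn X Y p = conn X' Y' p" using eq p by (simp add: conn_def)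
next
  fix X X' Y Y' :: "'e \<Rightarrow> 'e" and f :: "'e \<Rightarrow> real" and p
  assume vf: "vector_field N X" "vector_field N X'" "vector_field N Y" "vector_field N Y'"
    and f: "smooth_map N f" and p: "p \<in> N"
  note lin = tderiv_linear[OF vector_field_smooth_map[OF vf(3)] p]
  note sY = vector_field_smooth_map[OF vf(3)] vector_field_smooth_map[OF vf(4)]
  note tX = vector_field_tangent[OF vf(1) p]
  show "conn (\<lambda>x. X x + X' x) Y p = conn X Y p + conn X' Y p"
    by (simp add: conn_def B_add_left linear_add[OF lin])
  show "conn (\<lambda>x. f x *\<^sub>R X x) Y p = f p *\<^sub>R conn X Y p"
    by (simp add: conn_def B_scaleR_left linear_cmul[OF lin] scaleR_add_right)
  show "conn X (\<lambda>x. Y x + Y' x) p = conn X Y p + conn X Y' p"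
    by (simp add: conn_def B_add_right tderiv_add[OF sY p tX])
  show "conn X (\<lambda>x. f x *\<^sub>R Y x) p = tderiv N f p (X p) *\<^sub>R Y p + f p *\<^sub>R conn X Y p"
    by (simp add: conn_def B_scaleR_right tderiv_scaleR[OF f sY(1) p tX] scaleR_add_right)
qed

text \<open>\<open>B\<close> is orthogonal to \<open>I p\<close>, so only the Euclidean part of
  \<open>g\<close> sees it. Of the resulting terms, those with \<open>X p \<bullet> I p\<close>
  cancel because \<open>I\<close> is skew; the others match what the moving base point contributes
  to the derivative of \<open>(Y x \<bullet> I x) * (Z x \<bullet> I x)\<close>.\<close>

lemma conn_metric:
  assumes X: "vector_field N X" and Y: "vector_field N Y" and Z: "vector_field N Z" and p: "p \<in> N"
  shows "tderiv N (\<lambda>x. g x (Y x) (Z x)) p (X p) = g p (conn X Y p) (Z p) + g p (Y p) (conn X Z p)"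
proof -
  note tan = vector_field_tangent[OF _ p]
  note X0 = tangent_spaceD[OF p tan[OF X]]
  note Y0 = tangent_spaceD[OF p tan[OF Y]]
  note Z0 = tangent_spaceD[OF p tan[OF Z]]
  note dY = smooth_map_has_derivative[OF vector_field_smooth_map[OF Y] p]
  note dZ = smooth_map_has_derivative[OF vector_field_smooth_map[OF Z] p]
  note dI = bounded_linear.has_derivative[OF bounded_linear_I has_derivative_ident]
  let ?dY = "tderiv N Y p (X p)" and ?dZ = "tderiv N Z p (X p)"
  have "tderiv N (\<lambda>x. g x (Y x) (Z x)) p (X p) =
      tderiv N (\<lambda>x. s * (Y x \<bullet> Z x - c * (Y x \<bullet> I x) * (Z x \<bullet> I x))) p (X p)"
    by (subst tderiv_cong[OF g_eq p]) (use Y Z in \<open>auto intro: vector_field_tangent\<close>)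
  also have "\<dots> = s * (Y p \<bullet> ?dZ + ?dY \<bullet> Z p - c * ((Y p \<bullet> I p) * (Z p \<bullet> I (X p) + ?dZ \<bullet> I p)
      + (Y p \<bullet> I (X p) + ?dY \<bullet> I p) * (Z p \<bullet> I p)))"
    by (rule tderiv_eqI[OF _ tan[OF X]])
      (rule derivative_eq_intros dY dZ dI refl | simp add: algebra_simps)+
  also have "\<dots> = g p (conn X Y p) (Z p) + g p (Y p) (conn X Z p)"
  proof -
    have "I (X p) \<bullet> I p = 0" "I (Y p) \<bullet> I p = 0" "I (Z p) \<bullet> I p = 0"
      using X0 Y0 Z0 by (simp_all add: I_inner_I)
    then have "B p (X p) (Y p) \<bullet> I p = 0" "B p (X p) (Z p) \<bullet> I p = 0"
      by (simp_all add: B_inner_tangent I_skew inner_I_self)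
    moreover have "I (Z p) \<bullet> Y p = - (I (Y p) \<bullet> Z p)"
      using inner_I_swap[of "Y p" "Z p"] by (simp add: inner_commute)
    ultimately show ?thesis
      using X Y Z p Y0 Z0
      by (simp add: g_eq tan vector_field_conn)
        (simp add: conn_def inner_add_left inner_add_right B_inner_tangent inner_commute[of "Y p" "B _ _ _"]
          inner_commute[of "_ p" "I _"] inner_commute[of "Y p" "tderiv _ _ _ _"] algebra_simps)
  qed
  finally show ?thesis .
qed

lemma is_levi_civita_conn: "is_levi_civita N g conn"
  unfolding is_levi_civita_def
  by (auto simp: affine_connection_conn conn_metric conn_def lie_bracket_def B_commute)

lemma is_levi_civita_levi_civita: "is_levi_civita N g (levi_civita N g)"
  unfolding levi_civita_def by (rule someI[of _ conn]) (rule is_levi_civita_conn)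

lemma levi_civita_eq:
  "vector_field N X \<Longrightarrow> vector_field N Y \<Longrightarrow> p \<in> N \<Longrightarrow> levi_civita N g X Y p = conn X Y p"
  by (rule levi_civita_unique[OF riemannian_metric_g subspace_tangent_space_N
        is_levi_civita_levi_civita is_levi_civita_conn])

text \<open>Tangency follows from writing the bracket as \<open>conn X Y - conn Y X\<close>, where
  the symmetry of \<open>B\<close> cancels the corrections.\<close>

lemma vector_field_lie_bracket:
  assumes "vector_field N X" "vector_field N Y"
  shows "vector_field N (lie_bracket N X Y)"
  unfolding vector_field_def
proof (intro conjI ballI)
  have "smooth_map N (\<lambda>p. tderiv N Y p (X p) - tderiv N X p (Y p))"
    by (intro smooth_map_diff smooth_map_tderiv vector_field_smooth_map assms)
  then show "smooth_map N (lie_bracket N X Y)" by (simp add: lie_bracket_def[abs_def])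
  fix p
  assume p: "p \<in> N"
  have "lie_bracket N X Y p = conn X Y p - conn Y X p"
    by (simp add: conn_def lie_bracket_def B_commute)
  then show "lie_bracket N X Y p \<in> tangent_space N p"
    using subspace_diff[OF subspace_tangent_space_N[OF p]] vector_field_tangent[OF vector_field_conn p] assms
    by simp
qed

section \<open>Curvature of Berger metrics\<close>

text \<open>The derivative of \<open>B p v w\<close> in the base point \<open>p\<close>, in
  direction \<open>u\<close>, with \<open>v\<close> and \<open>w\<close> held fixed.\<close>

definition dB :: "'e \<Rightarrow> 'e \<Rightarrow> 'e \<Rightarrow> 'e \<Rightarrow> 'e" where
  "dB p u v w = (- 2 * c * \<kappa> * ((v \<bullet> I u) * (w \<bullet> I p) + (v \<bullet> I p) * (w \<bullet> I u))) *\<^sub>R p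
     + (\<kappa> * (v \<bullet> w) - 2 * c * \<kappa> * (v \<bullet> I p) * (w \<bullet> I p)) *\<^sub>R u
     - (c * (v \<bullet> I u)) *\<^sub>R I w - (c * (w \<bullet> I u)) *\<^sub>R I v"

lemma has_derivative_B:
  assumes Y: "(Y has_derivative Y') (at p within A)" and Z: "(Z has_derivative Z') (at p within A)"
  shows "((\<lambda>x. B x (Y x) (Z x)) has_derivative
    (\<lambda>u. dB p u (Y p) (Z p) + B p (Y' u) (Z p) + B p (Y p) (Z' u))) (at p within A)"
proof -
  note dI = bounded_linear.has_derivative[OF bounded_linear_I]
  show ?thesis
    unfolding B_def
    by (rule derivative_eq_intros Y Z dI refl)+
      (simp add: fun_eq_iff dB_def algebra_simps)
qed

text \<open>The curvature of a flat derivative plus \<open>B\<close>: the antisymmetrized derivative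
  of \<open>B\<close> and the commutator of \<open>B p u\<close> with \<open>B p v\<close>.\<close>

definition R :: "'e \<Rightarrow> 'e \<Rightarrow> 'e \<Rightarrow> 'e \<Rightarrow> 'e" where
  "R p u v w = dB p u v w - dB p v u w + B p u (B p v w) - B p v (B p u w)"

text \<open>Expanded for the cancellations in the curvature: the two terms with a first derivative
  of \<open>Z\<close> are together symmetric in \<open>X\<close> and \<open>Y\<close>, while the
  term with the derivative of \<open>Y\<close> antisymmetrizes to the bracket.\<close>

lemma conn_conn:
  assumes X: "vector_field N X" and Y: "vector_field N Y" and Z: "vector_field N Z" and p: "p \<in> N"
  shows "conn X (conn Y Z) p = tderiv N (\<lambda>x. tderiv N Z x (Y x)) p (X p)
    + dB p (X p) (Y p) (Z p) + B p (tderiv N Y p (X p)) (Z p) + B p (Y p) (tderiv N Z p (X p))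
    + B p (X p) (tderiv N Z p (Y p)) + B p (X p) (B p (Y p) (Z p))"
proof -
  note smooth = vector_field_smooth_map[OF Y] vector_field_smooth_map[OF Z]
  note tan = vector_field_tangent[OF X p]
  have "tderiv N (\<lambda>x. B x (Y x) (Z x)) p (X p) = dB p (X p) (Y p) (Z p) + B p (tderiv N Y p (X p)) (Z p)
      + B p (Y p) (tderiv N Z p (X p))"
    by (rule tderiv_eqI[OF has_derivative_B tan]) (intro smooth_map_has_derivative smooth p)+
  then have "tderiv N (\<lambda>x. tderiv N Z x (Y x) + B x (Y x) (Z x)) p (X p) =
      tderiv N (\<lambda>x. tderiv N Z x (Y x)) p (X p)
      + (dB p (X p) (Y p) (Z p) + B p (tderiv N Y p (X p)) (Z p) + B p (Y p) (tderiv N Z p (X p)))"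
    by (subst tderiv_add[OF smooth_map_tderiv[OF smooth(2) Y] smooth_map_B[OF smooth] p tan]) simp
  then show ?thesis
    by (simp add: conn_def[abs_def] B_add_right)
qed

lemma curvature_op_eq:
  assumes X: "vector_field N X" and Y: "vector_field N Y" and Z: "vector_field N Z" and p: "p \<in> N"
  shows "curvature_op N g X Y Z p = conn X (conn Y Z) p - conn Y (conn X Z) p - conn (lie_bracket N X Y) Z p"
    and "curvature_op N g X Y Z p = R p (X p) (Y p) (Z p)"
proof -
  note L = vector_field_lie_bracket[OF X Y]
  \<comment> \<open>\<open>levi_civita\<close> is known only on vector fields and at points of
    \<open>N\<close>. Hence the inner field is first exchanged for \<open>conn Y Z\<close> as a
    whole, by locality, before the outer derivative is evaluated.\<close>
  have iter: "levi_civita N g X (levi_civita N g Y Z) p = conn X (conn Y Z) p"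
    if "vector_field N X" "vector_field N Y" for X Y
  proof -
    have "levi_civita N g X (levi_civita N g Y Z) p = levi_civita N g X (conn Y Z) p"
      by (rule levi_civita_cong[OF is_levi_civita_levi_civita that(1,1)
            levi_civita_vector_field[OF is_levi_civita_levi_civita that(2) Z]
            vector_field_conn[OF that(2) Z] refl levi_civita_eq[OF that(2) Z] p])
    then show ?thesis
      by (simp add: levi_civita_eq[OF that(1) vector_field_conn[OF that(2) Z] p])
  qed
  show 1: "curvature_op N g X Y Z p = conn X (conn Y Z) p - conn Y (conn X Z) p - conn (lie_bracket N X Y) Z p"
    by (simp add: curvature_op_def Let_def iter X Y levi_civita_eq[OF L Z p])
  have "tderiv N (\<lambda>x. tderiv N Z x (Y x)) p (X p) =
      tderiv N (\<lambda>x. tderiv N Z x (X x)) p (Y p) + tderiv N Z p (lie_bracket N X Y p)"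
    using tderiv_lie_bracket[OF X Y vector_field_smooth_map[OF Z] p vector_field_tangent[OF L p]]
    by (simp add: algebra_simps)
  moreover have "B p (lie_bracket N X Y p) (Z p) = B p (tderiv N Y p (X p)) (Z p) - B p (tderiv N X p (Y p)) (Z p)"
    by (simp add: lie_bracket_def B_diff_left)
  ultimately show "curvature_op N g X Y Z p = R p (X p) (Y p) (Z p)"
    unfolding 1 conn_conn[OF X Y Z p] conn_conn[OF Y X Z p]
    by (simp add: conn_def R_def B_commute algebra_simps)
qed

text \<open>The THE is well defined because \<open>curvature_op_eq\<close> gives the same value for
  all extending fields and \<open>extension\<close> provides such fields. Tangency is read off from
  the expression through \<open>conn\<close>.\<close>

lemma curvature_tensor_eq:
  assumes p: "p \<in> N" and u: "u \<in> tangent_space N p" and v: "v \<in> tangent_space N p" and w: "w \<in> tangent_space N p"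
  shows "curvature_tensor N g p u v w = R p u v w" "R p u v w \<in> tangent_space N p"
proof -
  have ext: "vector_field N (extension z)" "extension z p = z" if "z \<in> tangent_space N p" for z
    using vector_field_extension extension_point[OF p that] tangent_spaceD(1)[OF p that] by auto
  have op: "curvature_op N g (extension u) (extension v) (extension w) p = R p u v w"
    using curvature_op_eq(2)[OF ext(1)[OF u] ext(1)[OF v] ext(1)[OF w] p] by (simp add: ext u v w)
  show "curvature_tensor N g p u v w = R p u v w"
    unfolding curvature_tensor_def
  proof (rule the_equality)
    show "\<exists>X Y Z. vector_field N X \<and> vector_field N Y \<and> vector_field N Z \<and>
        X p = u \<and> Y p = v \<and> Z p = w \<and> R p u v w = curvature_op N g X Y Z p"
      by (intro exI[of _ "extension u"] exI[of _ "extension v"] exI[of _ "extension w"])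
        (simp add: ext u v w op)
  next
    fix r
    assume "\<exists>X Y Z. vector_field N X \<and> vector_field N Y \<and> vector_field N Z \<and>
        X p = u \<and> Y p = v \<and> Z p = w \<and> r = curvature_op N g X Y Z p"
    then show "r = R p u v w"
      using curvature_op_eq(2) p by auto
  qed
  show "R p u v w \<in> tangent_space N p"
    unfolding op[symmetric] curvature_op_eq(1)[OF ext(1)[OF u] ext(1)[OF v] ext(1)[OF w] p]
    by (intro subspace_diff subspace_tangent_space_N p vector_field_tangent vector_field_conn
        vector_field_lie_bracket ext(1) u v w)
qed

lemma I_tangent:
  assumes "p \<in> N" "u \<in> tangent_space N p" "u \<bullet> I p = 0"
  shows "I u \<in> tangent_space N p"
  using assms by (simp add: tangent_space_N P_I I_skew)

text \<open>The second vector is \<open>- I u\<close> because \<open>\<phi>\<close> acts as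
  \<open>- I\<close> on tangent vectors orthogonal to \<open>I p\<close>.\<close>

lemma sectional_curvature_holomorphic:
  assumes p: "p \<in> N" and u: "u \<in> tangent_space N p" "u \<bullet> I p = 0" "u \<noteq> 0"
  shows "sectional_curvature N g p u (- I u) = (\<kappa> + 3 * c) / s"
proof -
  have v: "- I u \<in> tangent_space N p"
    using subspace_neg[OF subspace_tangent_space_N[OF p] I_tangent[OF p u(1,2)]] .
  note up = tangent_spaceD[OF p u(1)]
  define n where "n = u \<bullet> u"
  have n: "n \<noteq> 0" using u(3) by (simp add: n_def)
  have I: "I u \<bullet> u = 0" "u \<bullet> I u = 0" "I u \<bullet> I u = n" "I u \<bullet> I p = 0" "I u \<bullet> p = 0"
    "p \<bullet> I u = 0" "I p \<bullet> p = 0" "p \<bullet> I p = 0"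
    using up u(2) by (simp_all add: I_skew inner_I_self I_inner_I n_def inner_I_swap[of p u])
  \<comment> \<open>With \<open>v = w = - I u\<close>, the round term gives \<open>\<kappa>\<close>,
    the remaining part of \<open>dB p u v w\<close> gives \<open>2 * c\<close>, and
    \<open>- dB p v u w\<close> gives another \<open>c\<close>. The terms quadratic in
    \<open>B\<close> vanish.\<close>
  have "R p u (- I u) (- I u) \<bullet> u = n * n * (\<kappa> + 3 * c)"
    by (simp add: R_def dB_def B_def inner_diff_left inner_diff_right inner_add_left inner_add_right I u(2) up
        n_def[symmetric] algebra_simps)
  then have "g p (R p u (- I u) (- I u)) u = s * (n * n * (\<kappa> + 3 * c))"
    by (simp add: g_eq p u(1) curvature_tensor_eq(2)[OF p u(1) v v] u(2))
  moreover have "g p u u = s * n" "g p (- I u) (- I u) = s * n" "g p u (- I u) = 0"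
    using g_eq[OF p u(1) u(1)] g_eq[OF p v v] g_eq[OF p u(1) v] by (simp_all add: I u(2) n_def)
  ultimately show ?thesis
    unfolding sectional_curvature_def curvature_tensor_eq(1)[OF p u(1) v v]
    using n s_pos by (simp add: field_simps)
qed

text \<open>The scale \<open>s\<close> stays free since the same \<open>\<xi>\<close> and
  \<open>\<phi>\<close> are later combined with both the Sasaki metric and its quarter.\<close>

lemma constant_phi_curvature_eq:
  assumes \<xi>: "\<And>p. p \<in> N \<Longrightarrow> \<xi> p = 2 *\<^sub>R I p"
    and \<phi>: "\<And>p u. p \<in> N \<Longrightarrow> u \<in> tangent_space N p \<Longrightarrow> \<phi> p u = - I u - (\<kappa> * (u \<bullet> I p)) *\<^sub>R p"
  shows "constant_phi_curvature N \<xi> \<phi> g ((\<kappa> + 3 * c) / s)"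
  unfolding constant_phi_curvature_def
proof (intro ballI impI)
  fix p u
  assume p: "p \<in> N" and u: "u \<in> tangent_space N p" and "u \<noteq> 0 \<and> g p u (\<xi> p) = 0"
  then have *: "u \<noteq> 0" "g p u (2 *\<^sub>R I p) = 0" by (auto simp: \<xi>)
  have "2 *\<^sub>R I p \<in> tangent_space N p"
    by (intro subspace_scale subspace_tangent_space_N I_point_tangent p)
  with *(2) have "s * 2 * (u \<bullet> I p) * (1 - c * (p \<bullet> p)) = 0"
    by (simp add: g_eq p u I_inner_I algebra_simps)
  \<comment> \<open>This nonzero factor turns \<open>g\<close>-orthogonality to \<open>\<xi>\<close>
    into Euclidean orthogonality to \<open>I p\<close>.\<close>
  moreover have "c * (p \<bullet> p) \<noteq> 1"
  proof -
    have "p \<bullet> p \<noteq> 0" "\<kappa> * (p \<bullet> p) = 1" using p by (auto simp: N_def)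
    then show ?thesis using c(2) by (metis less_irrefl mult_right_cancel)
  qed
  ultimately have "u \<bullet> I p = 0" using s_pos by simp
  then show "sectional_curvature N g p u (\<phi> p u) = (\<kappa> + 3 * c) / s"
    using sectional_curvature_holomorphic[OF p u] *(1) by (simp add: \<phi> p u)
qed

end

subsection \<open>The Sasakian structure\<close>

text \<open>\<open>\<eta>\<close> is the \<open>g\<close>-dual of \<open>\<xi>\<close>: as
  \<open>p \<bullet> p = 2\<close>, the product of \<open>u\<close> with
  \<open>2 *\<^sub>R I p\<close> is \<open>1 / 4 * (2 - 1) * (u \<bullet> I p)\<close>. The value
  \<open>\<phi> p u\<close> is the tangential part of \<open>- I u\<close>.\<close>

locale hopf_contact = berger_sphere I P "1 / 2" "1 / 4" "1 / 4" g
  for I P :: "'e::euclidean_space \<Rightarrow> 'e" and g :: "'e metric" +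
  fixes \<xi> :: "'e \<Rightarrow> 'e" and \<eta> :: "'e \<Rightarrow> 'e \<Rightarrow> real" and \<phi> :: "'e \<Rightarrow> 'e \<Rightarrow> 'e"
  assumes \<xi>_eq: "p \<in> N \<Longrightarrow> \<xi> p = 2 *\<^sub>R I p"
    and \<eta>_eq: "p \<in> N \<Longrightarrow> u \<in> tangent_space N p \<Longrightarrow> \<eta> p u = (u \<bullet> I p) / 4"
    and \<phi>_eq: "p \<in> N \<Longrightarrow> u \<in> tangent_space N p \<Longrightarrow> \<phi> p u = - I u - (1 / 2 * (u \<bullet> I p)) *\<^sub>R p"
begin

lemma point_inner: "p \<in> N \<Longrightarrow> p \<bullet> p = 2"
  by (simp add: N_def)

lemma \<phi>_tangent:
  assumes "p \<in> N" "u \<in> tangent_space N p"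
  shows "\<phi> p u \<in> tangent_space N p"
proof -
  have "P p = p" using assms by (simp add: N_def)
  then show ?thesis
    using assms tangent_spaceD[OF assms]
    by (simp add: \<phi>_eq tangent_space_N P_I inner_diff_left I_skew point_inner)
qed

lemma \<phi>_inner_I_point:
  assumes "p \<in> N" "u \<in> tangent_space N p"
  shows "\<phi> p u \<bullet> I p = 0"
  using assms tangent_spaceD[OF assms]
  by (simp add: \<phi>_eq inner_diff_left I_inner_I inner_I_self)

lemma vector_field_\<xi>: "vector_field N \<xi>"
proof -
  have "smooth_map N (\<lambda>p. 2 *\<^sub>R I p)" by (intro smooth_map_intros)
  then have "smooth_map N \<xi>" by (simp add: smooth_map_cong[OF \<xi>_eq])
  moreover have "\<xi> p \<in> tangent_space N p" if "p \<in> N" for p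
    by (simp add: \<xi>_eq that I_point_tangent subspace_scale subspace_tangent_space_N)
  ultimately show ?thesis by (simp add: vector_field_def)
qed

lemma \<eta>_vector_field: "vector_field N X \<Longrightarrow> p \<in> N \<Longrightarrow> \<eta> p (X p) = 1 / 4 * (X p \<bullet> I p)"
  by (simp add: \<eta>_eq vector_field_tangent)

lemma \<phi>_vector_field:
  "vector_field N X \<Longrightarrow> p \<in> N \<Longrightarrow> \<phi> p (X p) = - I (X p) - (1 / 2 * (X p \<bullet> I p)) *\<^sub>R p"
  by (simp add: \<phi>_eq vector_field_tangent)

lemma smooth_map_\<eta>:
  assumes X: "vector_field N X"
  shows "smooth_map N (\<lambda>p. \<eta> p (X p))"
proof -
  have "smooth_map N (\<lambda>p. 1 / 4 * (X p \<bullet> I p))"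
    by (intro smooth_map_intros vector_field_smooth_map X)
  then show ?thesis by (simp only: smooth_map_cong[OF \<eta>_vector_field[OF X]])
qed

lemma vector_field_\<phi>:
  assumes X: "vector_field N X"
  shows "vector_field N (\<lambda>p. \<phi> p (X p))"
proof -
  have "smooth_map N (\<lambda>p. - I (X p) - (1 / 2 * (X p \<bullet> I p)) *\<^sub>R p)"
    by (intro smooth_map_intros vector_field_smooth_map X)
  then have "smooth_map N (\<lambda>p. \<phi> p (X p))" by (simp only: smooth_map_cong[OF \<phi>_vector_field[OF X]])
  then show ?thesis by (simp add: vector_field_def \<phi>_tangent vector_field_tangent[OF X])
qed

lemma tderiv_\<eta>:
  assumes X: "vector_field N X" and Y: "vector_field N Y" and p: "p \<in> N"
  shows "tderiv N (\<lambda>x. \<eta> x (Y x)) p (X p) = 1 / 4 * (Y p \<bullet> I (X p) + tderiv N Y p (X p) \<bullet> I p)"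
proof -
  have "tderiv N (\<lambda>x. \<eta> x (Y x)) p (X p) = tderiv N (\<lambda>x. 1 / 4 * (Y x \<bullet> I x)) p (X p)"
    by (simp only: tderiv_cong[OF \<eta>_vector_field[OF Y] p])
  also have "\<dots> = 1 / 4 * (Y p \<bullet> I (X p) + tderiv N Y p (X p) \<bullet> I p)"
    by (rule tderiv_eqI[OF has_derivative_mult_right[OF has_derivative_inner[OF
        smooth_map_has_derivative[OF vector_field_smooth_map[OF Y] p]
        bounded_linear.has_derivative[OF bounded_linear_I has_derivative_ident]]]
        vector_field_tangent[OF X p]])
  finally show ?thesis .
qed

lemma tderiv_\<phi>:
  assumes X: "vector_field N X" and Y: "vector_field N Y" and p: "p \<in> N"
  shows "tderiv N (\<lambda>x. \<phi> x (Y x)) p (X p) = - I (tderiv N Y p (X p))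
    - (1 / 2 * (Y p \<bullet> I (X p) + tderiv N Y p (X p) \<bullet> I p)) *\<^sub>R p - (1 / 2 * (Y p \<bullet> I p)) *\<^sub>R X p"
proof -
  note dI = bounded_linear.has_derivative[OF bounded_linear_I]
  note dY = smooth_map_has_derivative[OF vector_field_smooth_map[OF Y] p]
  have "tderiv N (\<lambda>x. \<phi> x (Y x)) p (X p) = tderiv N (\<lambda>x. - I (Y x) - (1 / 2 * (Y x \<bullet> I x)) *\<^sub>R x) p (X p)"
    by (simp only: tderiv_cong[OF \<phi>_vector_field[OF Y] p])
  also have "\<dots> = - I (tderiv N Y p (X p))
    - ((1 / 2 * (Y p \<bullet> I p)) *\<^sub>R X p + (1 / 2 * (Y p \<bullet> I (X p) + tderiv N Y p (X p) \<bullet> I p)) *\<^sub>R p)"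
    by (rule tderiv_eqI[OF has_derivative_diff[OF has_derivative_minus[OF dI[OF dY]]
        has_derivative_scaleR[OF has_derivative_mult_right[OF has_derivative_inner[OF dY
        dI[OF has_derivative_ident]]] has_derivative_ident]] vector_field_tangent[OF X p]])
  finally show ?thesis by (simp add: algebra_simps)
qed

lemma contact_metric_structure: "contact_metric_structure N \<xi> \<eta> \<phi> g"
  unfolding contact_metric_structure_def
proof (intro conjI allI ballI impI; (elim conjE)?)
  fix p u v a b
  assume p: "p \<in> N" and u: "u \<in> tangent_space N p" and v: "v \<in> tangent_space N p"
  note up = tangent_spaceD[OF p u] and vp = tangent_spaceD[OF p v]
  have t: "a *\<^sub>R u + b *\<^sub>R v \<in> tangent_space N p"
    using subspace_tangent_space_N[OF p] u v by (simp add: subspace_add subspace_scale)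
  show "\<eta> p (a *\<^sub>R u + b *\<^sub>R v) = a * \<eta> p u + b * \<eta> p v"
    by (simp add: \<eta>_eq p u v t inner_add_left add_divide_distrib)
  show "\<phi> p (a *\<^sub>R u + b *\<^sub>R v) = a *\<^sub>R \<phi> p u + b *\<^sub>R \<phi> p v"
    by (simp add: \<phi>_eq p u v t inner_add_left algebra_simps)
  show "\<phi> p u \<in> tangent_space N p" by (rule \<phi>_tangent[OF p u])
  show "\<phi> p (\<phi> p u) = - u + \<eta> p u *\<^sub>R \<xi> p"
    using \<phi>_inner_I_point[OF p u] \<phi>_eq[OF p \<phi>_tangent[OF p u]]
    by (simp add: \<phi>_eq[OF p u] \<eta>_eq[OF p u] \<xi>_eq[OF p])
  have "\<phi> p u \<bullet> \<phi> p v = u \<bullet> v - 1 / 2 * (u \<bullet> I p) * (v \<bullet> I p)"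
    using point_inner[OF p] inner_I_swap[of p v] I_skew[of u p]
    by (simp add: \<phi>_eq p u v inner_diff_left inner_diff_right I_inner_I algebra_simps)
  then show "g p (\<phi> p u) (\<phi> p v) = g p u v - \<eta> p u * \<eta> p v"
    by (simp add: g_eq \<eta>_eq p u v \<phi>_tangent \<phi>_inner_I_point algebra_simps)
next
  fix p
  assume p: "p \<in> N"
  then show "\<eta> p (\<xi> p) = 1"
    using \<eta>_vector_field[OF vector_field_\<xi> p] by (simp add: \<xi>_eq I_inner_I point_inner)
next
  fix X Y p
  assume X: "vector_field N X" and Y: "vector_field N Y" and p: "p \<in> N"
  \<comment> \<open>The derivatives of \<open>X\<close> and \<open>Y\<close> cancel against the
    bracket; only the derivative of \<open>I x\<close> in the base point is left.\<close>
  have "(tderiv N (\<lambda>x. \<eta> x (Y x)) p (X p) - tderiv N (\<lambda>x. \<eta> x (X x)) p (Y p)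
      - \<eta> p (lie_bracket N X Y p)) / 2 = (Y p \<bullet> I (X p) - X p \<bullet> I (Y p)) / 8"
    unfolding tderiv_\<eta>[OF X Y p] tderiv_\<eta>[OF Y X p] \<eta>_vector_field[OF vector_field_lie_bracket[OF X Y] p]
    by (simp add: lie_bracket_def inner_diff_left field_simps)
  also have "\<dots> = - (X p \<bullet> I (Y p)) / 4"
    using inner_I_swap[of "Y p" "X p"] by simp
  also have "\<dots> = g p (X p) (\<phi> p (Y p))"
    using tangent_spaceD[OF p vector_field_tangent[OF X p]]
    by (simp add: g_eq p vector_field_tangent X Y \<phi>_tangent \<phi>_inner_I_point)
      (simp add: \<phi>_vector_field[OF Y p] inner_diff_right)
  finally show "(tderiv N (\<lambda>x. \<eta> x (Y x)) p (X p) - tderiv N (\<lambda>x. \<eta> x (X x)) p (Y p)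
      - \<eta> p (lie_bracket N X Y p)) / 2 = g p (X p) (\<phi> p (Y p))" .
qed (auto intro: riemannian_metric_g vector_field_\<xi> smooth_map_\<eta> vector_field_\<phi>)

text \<open>The terms with the derivative of \<open>Y\<close> cancel, so the identity becomes
  algebraic in \<open>X p\<close> and \<open>Y p\<close>: contributions of \<open>B\<close> against
  the derivative of \<open>\<phi>\<close> in the base point.\<close>

lemma sasakian_identity:
  assumes X: "vector_field N X" and Y: "vector_field N Y" and p: "p \<in> N"
  shows "conn X (\<lambda>x. \<phi> x (Y x)) p - \<phi> p (conn X Y p) = g p (X p) (Y p) *\<^sub>R \<xi> p - \<eta> p (Y p) *\<^sub>R X p"
proof -
  note X0 = tangent_spaceD[OF p vector_field_tangent[OF X p]]
  note Y0 = tangent_spaceD[OF p vector_field_tangent[OF Y p]]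
  let ?x = "X p" and ?y = "Y p" and ?d = "tderiv N Y p (X p)"
  have zero: "I ?x \<bullet> I p = 0" "I ?y \<bullet> I p = 0" using X0 Y0 by (simp_all add: I_inner_I)
  then have BI: "B p ?x ?y \<bullet> I p = 0"
    by (simp add: B_inner_tangent I_skew inner_I_self)
  have "\<phi> p (conn X Y p) = - I ?d - I (B p ?x ?y) - (1 / 2 * (?d \<bullet> I p)) *\<^sub>R p"
    unfolding \<phi>_vector_field[OF vector_field_conn[OF X Y] p]
    by (simp add: conn_def inner_add_left BI)
  then have "conn X (\<lambda>x. \<phi> x (Y x)) p - \<phi> p (conn X Y p) =
      B p ?x (\<phi> p ?y) + I (B p ?x ?y) - (1 / 2 * (?y \<bullet> I ?x)) *\<^sub>R p - (1 / 2 * (?y \<bullet> I p)) *\<^sub>R ?x"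
    by (simp add: conn_def tderiv_\<phi>[OF X Y p] algebra_simps)
  also have "B p ?x (\<phi> p ?y) = (1 / 2 * (?y \<bullet> I ?x)) *\<^sub>R p - (1 / 4 * (?x \<bullet> I p)) *\<^sub>R I (\<phi> p ?y)"
  proof -
    have "?x \<bullet> \<phi> p ?y = ?y \<bullet> I ?x"
      unfolding \<phi>_vector_field[OF Y p] using X0 inner_I_swap[of ?x ?y] by (simp add: inner_diff_right)
    then show ?thesis
      by (simp add: B_def \<phi>_inner_I_point p vector_field_tangent Y)
  qed
  also have "I (\<phi> p ?y) = ?y - (1 / 2 * (?y \<bullet> I p)) *\<^sub>R I p"
    by (simp add: \<phi>_vector_field[OF Y p])
  also have "I (B p ?x ?y) = (1 / 2 * (?x \<bullet> ?y) - 1 / 4 * (?x \<bullet> I p) * (?y \<bullet> I p)) *\<^sub>R I p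
      + (1 / 4 * (?x \<bullet> I p)) *\<^sub>R ?y + (1 / 4 * (?y \<bullet> I p)) *\<^sub>R ?x"
    by (simp add: B_def)
  also have "(1 / 2 * (?y \<bullet> I ?x)) *\<^sub>R p - (1 / 4 * (?x \<bullet> I p)) *\<^sub>R (?y - (1 / 2 * (?y \<bullet> I p)) *\<^sub>R I p)
      + ((1 / 2 * (?x \<bullet> ?y) - 1 / 4 * (?x \<bullet> I p) * (?y \<bullet> I p)) *\<^sub>R I p
      + (1 / 4 * (?x \<bullet> I p)) *\<^sub>R ?y + (1 / 4 * (?y \<bullet> I p)) *\<^sub>R ?x)
      - (1 / 2 * (?y \<bullet> I ?x)) *\<^sub>R p - (1 / 2 * (?y \<bullet> I p)) *\<^sub>R ?x =
      (1 / 2 * (?x \<bullet> ?y) - 1 / 8 * (?x \<bullet> I p) * (?y \<bullet> I p)) *\<^sub>R I p - (1 / 4 * (?y \<bullet> I p)) *\<^sub>R ?x"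
  proof -
    \<comment> \<open>Coefficients are split as 1/2 = 1/4 + 1/4 and 1/4 = 1/8 + 1/8, so that scaled
      vectors cancel as opaque summands.\<close>
    have "(1 / 2 * (?y \<bullet> I p)) *\<^sub>R ?x = (1 / 4 * (?y \<bullet> I p)) *\<^sub>R ?x + (1 / 4 * (?y \<bullet> I p)) *\<^sub>R ?x"
      unfolding scaleR_add_left[symmetric] by simp
    moreover have "(1 / 4 * (?x \<bullet> I p)) *\<^sub>R (?y - (1 / 2 * (?y \<bullet> I p)) *\<^sub>R I p) =
        (1 / 4 * (?x \<bullet> I p)) *\<^sub>R ?y - (1 / 8 * (?x \<bullet> I p) * (?y \<bullet> I p)) *\<^sub>R I p"
      by (simp add: scaleR_diff_right)
    moreover have "(1 / 2 * (?x \<bullet> ?y) - 1 / 4 * (?x \<bullet> I p) * (?y \<bullet> I p)) *\<^sub>R I p =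
        (1 / 2 * (?x \<bullet> ?y) - 1 / 8 * (?x \<bullet> I p) * (?y \<bullet> I p)) *\<^sub>R I p
        - (1 / 8 * (?x \<bullet> I p) * (?y \<bullet> I p)) *\<^sub>R I p"
      unfolding scaleR_diff_left[symmetric] by simp
    ultimately show ?thesis by (simp only:) simp
  qed
  also have "(1 / 2 * (?x \<bullet> ?y) - 1 / 8 * (?x \<bullet> I p) * (?y \<bullet> I p)) *\<^sub>R I p = g p ?x ?y *\<^sub>R \<xi> p"
    by (simp add: g_eq \<xi>_eq p vector_field_tangent X Y algebra_simps)
  also have "1 / 4 * (?y \<bullet> I p) = \<eta> p ?y" by (simp add: \<eta>_vector_field[OF Y p])
  finally show ?thesis .
qed

lemma sasakian_manifold: "submanifold k N \<Longrightarrow> sasakian_manifold k N \<xi> \<eta> \<phi> g"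
  unfolding sasakian_manifold_def Let_def
  by (simp add: contact_metric_structure levi_civita_eq vector_field_\<phi> sasakian_identity)

end

subsection \<open>The image of a Hopf field\<close>

lemma tangent_space_mono: "M \<subseteq> N \<Longrightarrow> tangent_space M p \<subseteq> tangent_space N p"
  unfolding tangent_space_def by blast

text \<open>Differentiating the unit length of the vector part yields this necessary condition,
  which is enough to make the scalar in \<open>eta_bar\<close> unique.\<close>

lemma round_metric_unit_tangent_bundle_tangent:
  assumes "w \<in> tangent_space (unit_tangent_bundle M round_metric) Q"
  shows "snd w \<bullet> snd Q = 0"
proof -
  obtain \<gamma> :: "real \<Rightarrow> 'a \<times> 'a" where \<gamma>: "range \<gamma> \<subseteq> unit_tangent_bundle M round_metric" "\<gamma> 0 = Q"
    "(\<gamma> has_vector_derivative w) (at 0)"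
    using assms unfolding tangent_space_def by blast
  have "snd (\<gamma> t) \<bullet> snd (\<gamma> t) = 1" for t
  proof -
    have "\<gamma> t \<in> unit_tangent_bundle M round_metric" using \<gamma>(1) by auto
    then show ?thesis by (cases "\<gamma> t") (simp add: unit_tangent_bundle_def round_metric_def)
  qed
  moreover note d = has_derivative_snd[OF \<gamma>(3)[unfolded has_vector_derivative_def]]
  ultimately have "((\<lambda>t. 1 :: real) has_derivative
      (\<lambda>t. snd (\<gamma> 0) \<bullet> snd (t *\<^sub>R w) + snd (t *\<^sub>R w) \<bullet> snd (\<gamma> 0))) (at 0)"
    using has_derivative_inner[OF d d] by simp
  from fun_cong[OF has_derivative_unique[OF this has_derivative_const], of 1]
  show ?thesis by (simp add: inner_commute \<gamma>(2))
qed

locale hopf =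
  fixes I :: "'a::euclidean_space \<Rightarrow> 'a"
  assumes I: "orthogonal_complex_structure I"
begin

definition II :: "'a \<times> 'a \<Rightarrow> 'a \<times> 'a" where
  "II p = (I (fst p), I (snd p))"

text \<open>The orthogonal projection onto the graph of \<open>I\<close>.\<close>

definition graph_proj :: "'a \<times> 'a \<Rightarrow> 'a \<times> 'a" where
  "graph_proj p = ((1 / 2) *\<^sub>R (fst p - I (snd p)), (1 / 2) *\<^sub>R (I (fst p) + snd p))"

sublocale S: berger_sphere I id 1 0 1 round_metric
proof (intro berger_sphere.intro complex_sphere.intro berger_sphere_axioms.intro)
  show "linear I" "I (I x) = - x" "I x \<bullet> I y = x \<bullet> y" for x y
    using I by (simp_all add: orthogonal_complex_structure_def orthogonal_transformation_def)
qed (simp_all add: round_metric_def linear_id)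

text \<open>Only the sphere is introduced here. Its metrics follow in \<open>sasaki\<close> and
  \<open>contact\<close>, after the Sasaki metric has been computed with the horizontal lifts that
  \<open>S\<close> yields.\<close>

sublocale G: complex_sphere II graph_proj "1 / 2"
proof (rule complex_sphere.intro)
  show "linear II"
    by (rule linearI) (simp_all add: II_def)
  show "linear graph_proj"
    by (rule linearI) (simp_all add: graph_proj_def algebra_simps)
  show "II x \<bullet> II y = x \<bullet> y" for x y
    by (cases x, cases y) (simp add: II_def S.I_inner_I)
  show "graph_proj (II x) = II (graph_proj x)" for x
    by (simp add: graph_proj_def II_def algebra_simps)
qed (auto simp: II_def)

lemma S_N: "S.N = sphere 0 1"
  by (auto simp: S.N_def norm_eq_1)

lemma graph_proj_fixed: "graph_proj p = p \<longleftrightarrow> snd p = I (fst p)"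
proof
  assume "graph_proj p = p"
  then have "(1 / 2) *\<^sub>R (I (fst p) + snd p) = snd p" by (metis graph_proj_def snd_conv)
  then have "2 *\<^sub>R ((1 / 2) *\<^sub>R (I (fst p) + snd p)) = 2 *\<^sub>R snd p" by (rule arg_cong)
  then have "I (fst p) + snd p = snd p + snd p" by (simp only: scaleR_scaleR scaleR_2) simp
  then show "snd p = I (fst p)" by (metis add_right_imp_eq)
next
  assume *: "snd p = I (fst p)"
  have half: "(1 / 2) *\<^sub>R (x + x) = x" for x :: 'a
    unfolding scaleR_2[symmetric] by simp
  show "graph_proj p = p"
    unfolding graph_proj_def by (rule prod_eqI) (simp_all add: * half)
qed

lemma G_N: "G.N = (\<lambda>q. (q, I q)) ` sphere 0 1"
proof (intro equalityI subsetI)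
  fix p
  assume "p \<in> G.N"
  then have "snd p = I (fst p)" "p \<bullet> p = 2" by (auto simp: G.N_def graph_proj_fixed)
  then have "p = (fst p, I (fst p))" "fst p \<bullet> fst p = 1"
    by (simp_all add: prod_eq_iff inner_prod_def S.I_inner_I)
  then show "p \<in> (\<lambda>q. (q, I q)) ` sphere 0 1"
    by (intro image_eqI[of _ _ "fst p"]) (simp_all add: norm_eq_1)
qed (auto simp: G.N_def graph_proj_fixed S.I_inner_I norm_eq_1)

lemma G_tangent:
  assumes "q \<in> sphere 0 1"
  shows "tangent_space G.N (q, I q) = (\<lambda>a. (a, I a)) ` {a. a \<bullet> q = 0}"
proof -
  have "(q, I q) \<in> G.N" using assms by (simp add: G_N)
  then show ?thesis
    unfolding G.tangent_space_N[OF \<open>(q, I q) \<in> G.N\<close>] graph_proj_fixed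
    by (auto simp: S.I_inner_I)
qed

lemma S_tangent: "q \<in> sphere 0 1 \<Longrightarrow> tangent_space (sphere 0 1) q = {a :: 'a. a \<bullet> q = 0}"
  using S.tangent_space_N[of q] by (simp add: S_N)

section \<open>Sasaki metric and contact structure along the graph\<close>

text \<open>For \<open>c = 0\<close> the correction \<open>B\<close> is the second fundamental form
  of the sphere, so ambient minus covariant derivative depends only on the values at
  \<open>q\<close>. This makes the THE well defined and evaluates it.\<close>

lemma horizontal_lift_sphere:
  fixes q v a :: 'a
  assumes q: "q \<in> sphere 0 1" and v: "v \<bullet> q = 0" and a: "a \<bullet> q = 0"
  shows "horizontal_lift (sphere 0 1) round_metric (q, v) a = (a, - (a \<bullet> v) *\<^sub>R q)"
proof -
  have diff: "tderiv (sphere 0 1) V q (A q) - levi_civita (sphere 0 1) round_metric A V q = - (A q \<bullet> V q) *\<^sub>R q"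
    if "vector_field (sphere 0 1) A" "vector_field (sphere 0 1) V" for A V
    using S.levi_civita_eq[unfolded S_N, OF that q] by (simp add: S.conn_def S.B_def S_N)
  have ext: "vector_field (sphere 0 1) (S.extension z)" "z \<bullet> q = 0 \<Longrightarrow> S.extension z q = z" for z
    using S.vector_field_extension[unfolded S_N] by (auto simp: S.extension_def)
  have "(THE w. \<exists>A V. vector_field (sphere 0 1) A \<and> vector_field (sphere 0 1) V \<and> A q = a \<and> V q = v \<and>
           w = tderiv (sphere 0 1) V q a - levi_civita (sphere 0 1) round_metric A V q) = - (a \<bullet> v) *\<^sub>R q"
  proof (rule the_equality)
    show "\<exists>A V. vector_field (sphere 0 1) A \<and> vector_field (sphere 0 1) V \<and> A q = a \<and> V q = v \<and>
           - (a \<bullet> v) *\<^sub>R q = tderiv (sphere 0 1) V q a - levi_civita (sphere 0 1) round_metric A V q"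
      using diff[OF ext(1) ext(1), of v a] ext v a
      by (intro exI[of _ "S.extension a"] exI[of _ "S.extension v"]) simp
  next
    fix w
    assume "\<exists>A V. vector_field (sphere 0 1) A \<and> vector_field (sphere 0 1) V \<and> A q = a \<and> V q = v \<and>
           w = tderiv (sphere 0 1) V q a - levi_civita (sphere 0 1) round_metric A V q"
    then obtain A V where AV: "vector_field (sphere 0 1) A" "vector_field (sphere 0 1) V" "A q = a" "V q = v"
      "w = tderiv (sphere 0 1) V q a - levi_civita (sphere 0 1) round_metric A V q" by (elim exE conjE)
    show "w = - (a \<bullet> v) *\<^sub>R q" using diff[OF AV(1,2)] AV(3-5) by simp
  qed
  then show ?thesis by (simp add: horizontal_lift_def)
qed

context
  fixes q :: 'a
  assumes q: "q \<in> sphere 0 1"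
begin

lemma q_inner: "q \<bullet> q = 1" "I q \<bullet> I q = 1" "I q \<bullet> q = 0" "q \<bullet> I q = 0"
  using q by (simp_all add: norm_eq_1 S.I_inner_I S.inner_I_self S.I_skew)

text \<open>\<open>I a\<close> is the derivative of the Hopf field; the multiple of \<open>q\<close>
  removes its normal component, because
  \<open>I a \<bullet> q = - (a \<bullet> I q)\<close>.\<close>

lemma vertical_part_graph:
  "a \<bullet> q = 0 \<Longrightarrow> vertical_part (sphere 0 1) round_metric (q, I q) (a, I a) = I a + (a \<bullet> I q) *\<^sub>R q"
  by (simp add: vertical_part_def horizontal_lift_sphere[OF q] q_inner)

text \<open>The horizontal parts contribute \<open>a \<bullet> b\<close>, and the vertical parts
  contribute \<open>a \<bullet> b\<close> less the product of the removed normal components.\<close>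

lemma sasaki_metric_graph:
  assumes a: "a \<bullet> q = 0" and b: "b \<bullet> q = 0"
  shows "sasaki_metric (sphere 0 1) round_metric (q, I q) (a, I a) (b, I b) =
    2 * (a \<bullet> b) - (a \<bullet> I q) * (b \<bullet> I q)"
  using S.inner_I_swap[of q b] S.I_skew[of a q]
  by (simp add: sasaki_metric_def vertical_part_graph a b round_metric_def inner_add_left inner_add_right
      S.I_inner_I q_inner)

lemma tangent_J_graph:
  assumes a: "a \<bullet> q = 0"
  shows "tangent_J (sphere 0 1) round_metric (q, I q) (a, I a) = (- I a - (a \<bullet> I q) *\<^sub>R q, a)"
proof -
  \<comment> \<open>Orthogonality to \<open>I q\<close> makes the second component of the horizontal
    lift vanish.\<close>
  have "(I a + (a \<bullet> I q) *\<^sub>R q) \<bullet> q = 0" "(I a + (a \<bullet> I q) *\<^sub>R q) \<bullet> I q = 0"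
    using a by (simp_all add: inner_add_left q_inner S.I_skew S.I_inner_I)
  then show ?thesis
    by (simp add: tangent_J_def vertical_part_graph a vertical_lift_def horizontal_lift_sphere[OF q] q_inner)
qed

lemma eta_bar_graph:
  assumes a: "a \<bullet> q = 0"
  shows "eta_bar (sphere 0 1) round_metric (q, I q) (a, I a) = a \<bullet> I q"
  unfolding eta_bar_def tangent_J_graph[OF a]
proof (rule the_equality)
  \<comment> \<open>The remainder equals \<open>(?b, I ?b)\<close> and is thus tangent to the graph
    itself, which is the invariance of the image under \<open>phi_bar\<close>. The inclusion of the
    graph in the unit tangent bundle then gives existence of the scalar.\<close>
  let ?b = "- I a - (a \<bullet> I q) *\<^sub>R q"
  have "G.N \<subseteq> unit_tangent_bundle (sphere 0 1) round_metric"
    by (auto simp: G_N unit_tangent_bundle_def S_tangent round_metric_def S.I_inner_I S.inner_I_self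
        S.I_skew norm_eq_1)
  moreover have "?b \<bullet> q = 0"
    by (simp add: inner_diff_left q_inner S.I_skew)
  then have "(?b, I ?b) \<in> tangent_space G.N (q, I q)"
    by (auto simp: G_tangent[OF q])
  ultimately have "(?b, I ?b) \<in> tangent_space (unit_tangent_bundle (sphere 0 1) round_metric) (q, I q)"
    by (rule tangent_space_mono[THEN subsetD])
  then show "(?b, a) - (a \<bullet> I q) *\<^sub>R vertical_lift (q, I q) (snd (q, I q))
      \<in> tangent_space (unit_tangent_bundle (sphere 0 1) round_metric) (q, I q)"
    by (simp add: vertical_lift_def)
next
  fix r
  assume "(- I a - (a \<bullet> I q) *\<^sub>R q, a) - r *\<^sub>R vertical_lift (q, I q) (snd (q, I q))
      \<in> tangent_space (unit_tangent_bundle (sphere 0 1) round_metric) (q, I q)"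
  from round_metric_unit_tangent_bundle_tangent[OF this]
  show "r = a \<bullet> I q"
    by (simp add: vertical_lift_def inner_diff_left q_inner)
qed

lemma phi_bar_graph:
  "a \<bullet> q = 0 \<Longrightarrow> phi_bar (sphere 0 1) round_metric (q, I q) (a, I a) =
    (- I a - (a \<bullet> I q) *\<^sub>R q, a - (a \<bullet> I q) *\<^sub>R I q)"
  by (simp add: phi_bar_def tangent_J_graph eta_bar_graph vertical_lift_def)

lemma xi_bar_graph: "xi_bar (sphere 0 1) round_metric (q, I q) = (I q, - q)"
  by (simp add: xi_bar_def tangent_J_def vertical_part_def vertical_lift_def horizontal_lift_sphere[OF q] q_inner)

end

lemma G_N_cases:
  assumes "p \<in> G.N"
  obtains q where "q \<in> sphere 0 1" "p = (q, I q)"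
  using assms by (auto simp: G_N)

lemma G_tangent_cases:
  assumes "u \<in> tangent_space G.N (q, I q)" "q \<in> sphere 0 1"
  obtains a where "a \<bullet> q = 0" "u = (a, I a)"
  using assms by (auto simp: G_tangent)

text \<open>For graph vectors \<open>u \<bullet> v = 2 * (a \<bullet> b)\<close> and
  \<open>u \<bullet> II p = 2 * (a \<bullet> I q)\<close>; the square of the second factor 2 is the
  origin of \<open>1 / 4\<close>.\<close>

lemma sasaki_metric_eq:
  assumes p: "p \<in> G.N" and u: "u \<in> tangent_space G.N p" and v: "v \<in> tangent_space G.N p"
  shows "sasaki_metric (sphere 0 1) round_metric p u v = u \<bullet> v - 1 / 4 * (u \<bullet> II p) * (v \<bullet> II p)"
proof -
  obtain q where q: "q \<in> sphere 0 1" "p = (q, I q)" using G_N_cases[OF p] .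
  obtain a where a: "a \<bullet> q = 0" "u = (a, I a)" using G_tangent_cases[OF u[unfolded q(2)] q(1)] .
  obtain b where b: "b \<bullet> q = 0" "v = (b, I b)" using G_tangent_cases[OF v[unfolded q(2)] q(1)] .
  show ?thesis
    unfolding q(2) a(2) b(2) sasaki_metric_graph[OF q(1) a(1) b(1)]
    by (simp add: II_def S.I_inner_I S.I_skew)
qed

lemma xi_tilde_eq: "p \<in> G.N \<Longrightarrow> xi_tilde (sphere 0 1) round_metric p = 2 *\<^sub>R II p"
  by (erule G_N_cases) (simp add: xi_tilde_def xi_bar_graph II_def)

lemma eta_tilde_eq:
  assumes p: "p \<in> G.N" and u: "u \<in> tangent_space G.N p"
  shows "eta_tilde (sphere 0 1) round_metric p u = (u \<bullet> II p) / 4"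
proof -
  obtain q where q: "q \<in> sphere 0 1" "p = (q, I q)" using G_N_cases[OF p] .
  obtain a where a: "a \<bullet> q = 0" "u = (a, I a)" using G_tangent_cases[OF u[unfolded q(2)] q(1)] .
  show ?thesis
    unfolding q(2) a(2) eta_tilde_def eta_bar_graph[OF q(1) a(1)]
    by (simp add: II_def S.I_skew)
qed

lemma phi_tilde_eq:
  assumes p: "p \<in> G.N" and u: "u \<in> tangent_space G.N p"
  shows "phi_tilde (sphere 0 1) round_metric p u = - II u - (1 / 2 * (u \<bullet> II p)) *\<^sub>R p"
proof -
  obtain q where q: "q \<in> sphere 0 1" "p = (q, I q)" using G_N_cases[OF p] .
  obtain a where a: "a \<bullet> q = 0" "u = (a, I a)" using G_tangent_cases[OF u[unfolded q(2)] q(1)] .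
  show ?thesis
    unfolding q(2) a(2) phi_tilde_def phi_bar_graph[OF q(1) a(1)]
    by (simp add: II_def S.I_skew)
qed

text \<open>Two metrics on the same sphere: this one, with \<open>s = 1\<close>, gives the curvature
  5/4; the next, with \<open>s = 1 / 4\<close>, carries the Sasakian identity.\<close>

sublocale sasaki: berger_sphere II graph_proj "1 / 2" "1 / 4" 1 "sasaki_metric (sphere 0 1) round_metric"
  by unfold_locales (simp_all add: sasaki_metric_eq)

sublocale contact: hopf_contact II graph_proj "g_cm (sphere 0 1) round_metric"
  "xi_tilde (sphere 0 1) round_metric" "eta_tilde (sphere 0 1) round_metric" "phi_tilde (sphere 0 1) round_metric"
  by unfold_locales (simp_all add: sasaki_metric_eq g_cm_def xi_tilde_eq eta_tilde_eq phi_tilde_eq)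

section \<open>The graph as a regular level set\<close>

lemma submanifold_graph:
  assumes dim: "DIM('a) = 2 * m + 2"
  shows "submanifold (2 * m + 1) G.N"
  unfolding submanifold_def
proof
  fix p
  assume "p \<in> G.N"
  then obtain q where q: "q \<in> sphere 0 1" "p = (q, I q)" by (rule G_N_cases)
  \<comment> \<open>The sphere equation and the graph equation together. The scalar one is placed on
    the line through \<open>q\<close>, so that values stay in the ambient space and the codimension
    is \<open>1 + DIM('a)\<close>.\<close>
  define F :: "'a \<times> 'a \<Rightarrow> 'a \<times> 'a" where
    "F x = ((fst x \<bullet> fst x - 1) *\<^sub>R q, snd x - I (fst x))" for x
  define F' :: "'a \<times> 'a \<Rightarrow> 'a \<times> 'a" where
    "F' h = ((fst h \<bullet> q + q \<bullet> fst h) *\<^sub>R q, snd h - I (fst h))" for h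
  define C where "C = span {q} \<times> (UNIV :: 'a set)"
  have qn: "q \<noteq> 0" "q \<bullet> q = 1" using q(1) by (auto simp: norm_eq_1)
  have "dim (span {q}) = 1" using qn(1) by (simp add: dim_span dim_singleton)
  then have dimC: "dim C + (2 * m + 1) = DIM('a \<times> 'a)"
    unfolding C_def using dim by (subst dim_Times) (auto simp: subspace_span)
  have der: "(F has_derivative F') (at p)"
    unfolding F_def F'_def q(2)
    by (auto intro!: derivative_eq_intros bounded_linear.has_derivative[OF S.bounded_linear_I] simp: inner_commute)
  have lin_fst: "bounded_linear (\<lambda>x. (x, 0) :: 'a \<times> 'a)" "bounded_linear (\<lambda>x. (0, x) :: 'a \<times> 'a)"
    by (simp_all add: bounded_linear_Pair bounded_linear_ident bounded_linear_zero)
  have sm: "smooth_on fst (UNIV :: ('a \<times> 'a) set)" "smooth_on snd (UNIV :: ('a \<times> 'a) set)"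
    using smooth_on_bounded_linear[OF bounded_linear_fst open_UNIV smooth_on_id[OF open_UNIV]]
      smooth_on_bounded_linear[OF bounded_linear_snd open_UNIV smooth_on_id[OF open_UNIV]] by auto
  \<comment> \<open>\<open>F\<close> is spelled with sums and injections of the two factors, to
    match the closure rules for smoothness.\<close>
  have "smooth_on (\<lambda>x. (((fst x \<bullet> fst x + (- 1)) *\<^sub>R q, 0) + (0, snd x)) + (0, - I (fst x))) (UNIV :: ('a \<times> 'a) set)"
    by (intro smooth_on_add smooth_on_bounded_linear[OF lin_fst(1)] smooth_on_bounded_linear[OF lin_fst(2)]
        smooth_on_bounded_bilinear[OF bounded_bilinear_scaleR]
        smooth_on_bounded_bilinear[OF bounded_bilinear_inner]
        smooth_on_bounded_linear[OF bounded_linear_minus[OF S.bounded_linear_I]]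
        smooth_on_const sm open_UNIV)
  then have "smooth_on F UNIV" by (simp add: F_def[abs_def])
  moreover have "F ` UNIV \<subseteq> C"
    unfolding F_def C_def by (auto simp: span_singleton)
  moreover have "G.N \<inter> UNIV = {x \<in> UNIV. F x = 0}"
    using qn(1) by (auto simp: F_def G_N norm_eq_1 image_iff prod_eq_iff zero_prod_def)
  moreover have "range (frechet_derivative F (at p)) = C"
  proof -
    have "range F' = C"
    proof (intro equalityI subsetI)
      fix y
      assume "y \<in> C"
      then obtain t w where y: "y = (t *\<^sub>R q, w)" by (auto simp: C_def span_singleton)
      \<comment> \<open>Halving \<open>t\<close> undoes the doubling in the derivative of the
        squared norm; the second entry offsets the term with \<open>I\<close>.\<close>
      have "F' ((t / 2) *\<^sub>R q, w + (t / 2) *\<^sub>R I q) = y"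
        by (simp add: F'_def y qn(2))
      then show "y \<in> range F'" by (metis rangeI)
    qed (auto simp: F'_def C_def span_singleton)
    then show ?thesis using frechet_derivative_at[OF der] by simp
  qed
  ultimately show "\<exists>U C. \<exists>F :: 'a \<times> 'a \<Rightarrow> 'a \<times> 'a. open U \<and> p \<in> U \<and> subspace C \<and>
      dim C + (2 * m + 1) = DIM('a \<times> 'a) \<and> smooth_on F U \<and> F ` U \<subseteq> C \<and> G.N \<inter> U = {x \<in> U. F x = 0} \<and>
      range (frechet_derivative F (at p)) = C"
    using dimC by (intro exI[of _ UNIV] exI[of _ C] exI[of _ F]) (simp add: C_def subspace_Times subspace_span)
qed

end

theorem theorem4p1:
  fixes \<xi> :: "'a::euclidean_space \<Rightarrow> 'a" and m :: nat
  assumes "DIM('a) = 2 * m + 2"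
    and "hopf_vector_field \<xi>"
  defines "S \<equiv> sphere (0::'a) 1"
  shows "(\<exists>c. sasakian_space_form (2 * m + 1) (field_image \<xi>)
            (xi_tilde S round_metric) (eta_tilde S round_metric) (phi_tilde S round_metric)
            (g_cm S round_metric) c) \<and>
         constant_phi_curvature (field_image \<xi>)
            (xi_tilde S round_metric) (phi_tilde S round_metric)
            (sasaki_metric S round_metric) (5 / 4)"
proof -
  obtain I where hopf: "orthogonal_complex_structure I" "\<forall>x\<in>sphere 0 1. \<xi> x = I x"
    using assms(2) unfolding hopf_vector_field_def by blast
  interpret hopf I by unfold_locales (rule hopf(1))
  have N: "field_image \<xi> = G.N"
    unfolding field_image_def G_N by (rule image_cong) (use hopf(2) in auto)
  have "sasakian_manifold (2 * m + 1) G.N (xi_tilde S round_metric) (eta_tilde S round_metric)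
      (phi_tilde S round_metric) (g_cm S round_metric)"
    unfolding S_def by (rule contact.sasakian_manifold[OF submanifold_graph[OF assms(1)]])
  \<comment> \<open>With \<open>s = 1 / 4\<close> the value is 5, which serves as the witness
    \<open>c\<close>; the value 5/4 belongs to the Sasaki metric treated next.\<close>
  moreover have "constant_phi_curvature G.N (xi_tilde S round_metric) (phi_tilde S round_metric)
      (g_cm S round_metric) ((1 / 2 + 3 * (1 / 4)) / (1 / 4))"
    unfolding S_def by (rule contact.constant_phi_curvature_eq[OF xi_tilde_eq phi_tilde_eq])
  moreover have "constant_phi_curvature G.N (xi_tilde S round_metric) (phi_tilde S round_metric)
      (sasaki_metric S round_metric) ((1 / 2 + 3 * (1 / 4)) / 1)"
    unfolding S_def by (rule sasaki.constant_phi_curvature_eq[OF xi_tilde_eq phi_tilde_eq])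
  ultimately show ?thesis
    unfolding N sasakian_space_form_def by auto
qed

end
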